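(* There exist constants $\varepsilon_0\in(0,1)$, $N_0$ and $C>0$, which do not depend on $N$, $\varepsilon$, $A$ or $B$ (they may depend on the phase $\Psi$), such that the following holds. Let $N\ge N_0$ be a power of $2$, let $0<\varepsilon\le\varepsilon_0$, and let $A\in T_X$ and $B\in T_P$ be boxes obeying $w(A)\,w(B)=1/N$. Then there exist an integer $r_\varepsilon\le C\log^4(1/\varepsilon)$ and complex-valued functions $\alpha^{AB}_t$ on $A$ and $\beta^{AB}_t$ on $B$, $1\le t\le r_\varepsilon$, such that $$\left| e^{2\pi i N R^{AB}(x,p)}-\sum_{t=1}^{r_\varepsilon}\alpha^{AB}_t(x)\,\beta^{AB}_t(p)\right|\le\varepsilon\qquad\text{for all }x\in A,\ p\in B .$$ Moreover: (1) when $w(B)\le 1/\sqrt N$, the functions $\{\beta^{AB}_t(p)\}_t$ can all be chosen as monomials in $p-p_0(B)$ (that is, of the form $(p-p_0(B))^k$ with $k$ a multi-index) of degree $|k|\le C\log^2(1/\varepsilon)$; (2) when $w(A)\le 1/\sqrt N$, the functions $\{\alpha^{AB}_t(x)\}_t$ can all be chosen as monomials in $x-x_0(A)$ (that is, of the form $(x-x_0(A))^k$ with $k$ a multi-index) of degree $|k|\le C\log^2(1/\varepsilon)$.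
   Context: Multi-indices: for $i=(i_1,i_2)$ with integers $i_1,i_2\ge0$, $|i|=i_1+i_2$, $i!=i_1!\,i_2!$, and $y^i=y_1^{i_1}y_2^{i_2}$ for $y=(y_1,y_2)$. Phase: $\Phi(x,k)$ is a real-valued phase function, $x\in[0,1]^2$, $k\in\mathbb R^2$, smooth in $(x,k)$ for $k\ne0$ and homogeneous of degree 1 in $k$: $\Phi(x,\lambda k)=\lambda\Phi(x,k)$ for all $\lambda>0$. For $x\in[0,1]^2$ and $p=(p_1,p_2)\in[0,1]^2$ set $$\Psi(x,p)=\frac{\sqrt2}{2}\,\Phi\big(x,(\cos2\pi p_2,\sin2\pi p_2)\big)\,p_1 .$$ It is assumed that $\Psi$ is real-analytic in the joint variables $(x,p)$, in the sense that there are constants $Q,R>0$ with $$\sup_{x,p\in[0,1]^2}\left|\partial_x^i\partial_p^j\Psi(x,p)\right|\le Q\,i!\,j!\,R^{-|i|-|j|}\qquad\text{for all multi-indices } i,j .$$ The function $\Psi$ is fixed and independent of $N$. Trees: for $N$ a power of 2, $T_X$ (in the $x$ variable) and $T_P$ (in the $p$ variable) are the quadtrees obtained by uniform recursive dyadic partitioning of $[0,1]^2$ until the finest boxes have sidelength $1/N$; thus their boxes are the dyadic squares in $[0,1]^2$ of sidelength $2^{-\ell}$, $\ell=0,1,\dots,\log_2N$. For a box, $w(\cdot)$ denotes its sidelength; $x_0(A)$ is the center of $A\in T_X$ and $p_0(B)$ is the center of $B\in T_P$. Residual phase: for $x\in A$, $p\in B$, $$R^{AB}(x,p)=\Psi(x,p)-\Psi(x_0(A),p)-\Psi(x,p_0(B))+\Psi(x_0(A),p_0(B))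 .$$ *)

theory Defs
  imports "HOL-Analysis.Analysis"
begin

section \<open>Multi-indices\<close>

definition mi_abs :: "nat ^ 2 \<Rightarrow> nat" where
  "mi_abs i = i $ 1 + i $ 2"

definition mi_fact :: "nat ^ 2 \<Rightarrow> nat" where
  "mi_fact i = fact (i $ 1) * fact (i $ 2)"

definition mi_power :: "real ^ 2 \<Rightarrow> nat ^ 2 \<Rightarrow> real" where
  "mi_power y i = (y $ 1) ^ (i $ 1) * (y $ 2) ^ (i $ 2)"

section \<open>Smoothness and partial derivatives\<close>

abbreviation unit_square :: "(real ^ 2) set" where
  "unit_square \<equiv> cbox 0 1"

text \<open>Meaningful for open \<open>U\<close> only: \<open>f\<close> is \<open>n\<close> times continuously differentiable on \<open>U\<close>.\<close>

primrec Ck_on :: "nat \<Rightarrow> 'a::euclidean_space set \<Rightarrow> ('a \<Rightarrow> real) \<Rightarrow> bool" where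
  "Ck_on 0 U f \<longleftrightarrow> continuous_on U f"
| "Ck_on (Suc n) U f \<longleftrightarrow>
     f differentiable_on U \<and> (\<forall>b\<in>Basis. Ck_on n U (\<lambda>z. frechet_derivative f (at z) b))"

text \<open>Smoothness on an arbitrary set (here the product of a closed square with a punctured plane)
  means being the restriction of a smooth function on an open neighbourhood.\<close>

definition smooth_on :: "'a::euclidean_space set \<Rightarrow> ('a \<Rightarrow> real) \<Rightarrow> bool" where
  "smooth_on S f \<longleftrightarrow>
     (\<exists>U g. open U \<and> S \<subseteq> U \<and> (\<forall>z\<in>S. g z = f z) \<and> (\<forall>n. Ck_on n U g))"

text \<open>Partial derivatives of functions on \<open>unit_square \<times> unit_square\<close>; on the boundary they
  are one-sided, so only values on the two closed squares enter.\<close>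

definition partial_x :: "2 \<Rightarrow> (real ^ 2 \<Rightarrow> real ^ 2 \<Rightarrow> real) \<Rightarrow> real ^ 2 \<Rightarrow> real ^ 2 \<Rightarrow> real" where
  "partial_x m f x p =
     vector_derivative (\<lambda>t. f (\<chi> l. if l = m then t else x $ l) p) (at (x $ m) within {0..1})"

definition partial_p :: "2 \<Rightarrow> (real ^ 2 \<Rightarrow> real ^ 2 \<Rightarrow> real) \<Rightarrow> real ^ 2 \<Rightarrow> real ^ 2 \<Rightarrow> real" where
  "partial_p m f x p =
     vector_derivative (\<lambda>t. f x (\<chi> l. if l = m then t else p $ l)) (at (p $ m) within {0..1})"

definition mixed_partial ::
  "nat ^ 2 \<Rightarrow> nat ^ 2 \<Rightarrow> (real ^ 2 \<Rightarrow> real ^ 2 \<Rightarrow> real) \<Rightarrow> real ^ 2 \<Rightarrow> real ^ 2 \<Rightarrow> real" where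
  "mixed_partial i j f =
     (partial_x 1 ^^ (i $ 1)) ((partial_x 2 ^^ (i $ 2))
       ((partial_p 1 ^^ (j $ 1)) ((partial_p 2 ^^ (j $ 2)) f)))"

section \<open>The phase\<close>

definition Psi :: "(real ^ 2 \<Rightarrow> real ^ 2 \<Rightarrow> real) \<Rightarrow> real ^ 2 \<Rightarrow> real ^ 2 \<Rightarrow> real" where
  "Psi \<Phi> x p = sqrt 2 / 2 * \<Phi> x (vector [cos (2 * pi * p $ 2), sin (2 * pi * p $ 2)]) * p $ 1"

definition smooth_phase :: "(real ^ 2 \<Rightarrow> real ^ 2 \<Rightarrow> real) \<Rightarrow> bool" where
  "smooth_phase \<Phi> \<longleftrightarrow> smooth_on (unit_square \<times> (UNIV - {0})) (\<lambda>(x, k). \<Phi> x k)"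

definition homogeneous_phase :: "(real ^ 2 \<Rightarrow> real ^ 2 \<Rightarrow> real) \<Rightarrow> bool" where
  "homogeneous_phase \<Phi> \<longleftrightarrow>
     (\<forall>x\<in>unit_square. \<forall>k. \<forall>c>0. \<Phi> x (c *\<^sub>R k) = c * \<Phi> x k)"

definition analytic_bound :: "real \<Rightarrow> real \<Rightarrow> (real ^ 2 \<Rightarrow> real ^ 2 \<Rightarrow> real) \<Rightarrow> bool" where
  "analytic_bound Q R f \<longleftrightarrow>
     (\<forall>i j. \<forall>x\<in>unit_square. \<forall>p\<in>unit_square.
        \<bar>mixed_partial i j f x p\<bar>
          \<le> Q * real (mi_fact i) * real (mi_fact j) / R ^ (mi_abs i + mi_abs j))"

section \<open>Quadtrees\<close>

text \<open>\<open>Dyadic l m\<close> is the dyadic square of sidelength \<open>2^(-l)\<close> whose lower left corner is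
  \<open>m / 2^l\<close>. Squares are taken closed.\<close>

datatype dyadic = Dyadic (level: nat) (pos: "nat ^ 2")

definition width :: "dyadic \<Rightarrow> real" where
  "width A = 1 / 2 ^ level A"

definition center :: "dyadic \<Rightarrow> real ^ 2" where
  "center A = (\<chi> c. (real (pos A $ c) + 1 / 2) * width A)"

definition points :: "dyadic \<Rightarrow> (real ^ 2) set" where
  "points A = cbox (\<chi> c. real (pos A $ c) * width A) (\<chi> c. (real (pos A $ c) + 1) * width A)"

definition quadtree :: "nat \<Rightarrow> dyadic set" where
  "quadtree N = {A. real (level A) \<le> log 2 (real N) \<and> points A \<subseteq> unit_square}"

section \<open>Residual phase and separated approximations\<close>

definition residual_phase ::
  "(real ^ 2 \<Rightarrow> real ^ 2 \<Rightarrow> real) \<Rightarrow> dyadic \<Rightarrow> dyadic \<Rightarrow> real ^ 2 \<Rightarrow> real ^ 2 \<Rightarrow> real" where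
  "residual_phase \<Psi> A B x p =
     \<Psi> x p - \<Psi> (center A) p - \<Psi> x (center B) + \<Psi> (center A) (center B)"

definition separated_approx ::
  "(real ^ 2 \<Rightarrow> real ^ 2 \<Rightarrow> real) \<Rightarrow> nat \<Rightarrow> real \<Rightarrow> dyadic \<Rightarrow> dyadic \<Rightarrow> nat
     \<Rightarrow> (nat \<Rightarrow> real ^ 2 \<Rightarrow> complex) \<Rightarrow> (nat \<Rightarrow> real ^ 2 \<Rightarrow> complex) \<Rightarrow> bool" where
  "separated_approx \<Psi> N \<epsilon> A B r \<alpha> \<beta> \<longleftrightarrow>
     (\<forall>x\<in>points A. \<forall>p\<in>points B.
        cmod (exp (2 * of_real pi * \<i> * of_nat N * of_real (residual_phase \<Psi> A B x p))
              - (\<Sum>t=1..r. \<alpha> t x * \<beta> t p)) \<le> \<epsilon>)"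

definition centered_monomials :: "dyadic \<Rightarrow> nat \<Rightarrow> real \<Rightarrow> (nat \<Rightarrow> real ^ 2 \<Rightarrow> complex) \<Rightarrow> bool" where
  "centered_monomials A r d f \<longleftrightarrow>
     (\<forall>t\<in>{1..r}. \<exists>k. real (mi_abs k) \<le> d \<and>
        (\<forall>y\<in>points A. f t y = of_real (mi_power (y - center A) k)))"

end

(* By the Lipschitz bound in x, every p-derivative of R^{AB}(x, .) of order j is at most
   (Q/R) w(A) j! R^{-|j|}.  When w(B) <= R/2, hence for w(B) <= 1/sqrt N and N large, the Taylor
   polynomial of order d of N R^{AB}(x, .) at the center of B therefore has error O(2^-d), because
   N w(A) w(B) = 1; in particular N R^{AB} itself is O(1).  Truncating the exponential series at
   order d as well costs another O(2^-d) and leaves a polynomial in p - p_0(B) of degree at most d^2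
   in each variable, and d = O(log (1/eps)) suffices.  The case w(A) <= 1/sqrt N is the same with x and p
   exchanged, once x- and p-derivatives are known to commute. *)
theory Submission
  imports Defs
begin

section \<open>Smooth kernels\<close>

text \<open>\<open>analytic_bound\<close> bounds values of \<open>vector_derivative\<close>, which
  is an unspecified choice where no derivative exists, so by itself it says nothing about increments
  of \<open>Psi\<close>. Differentiability has to come from \<open>smooth_phase\<close>, which is
  phrased through Frechet derivatives on an open neighbourhood, whereas the partials are iterated
  one-sided derivatives in single coordinates. Smooth kernels bridge the two. Only one variable is
  expanded. The other enters through coefficients chosen point by point, so its box may be large.
  The powers of the logarithm are a count: a polynomial of degree at most d^2 in each of two
  variables has (d^2 + 1)^2 monomials, of total degree at most 2 d^2. Since w(A) w(B) = 1/N, one of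
  the boxes always has side at most 1/sqrt N, so the two special cases cover the general
  one.\<close>

text \<open>Membership in a class closed under directional derivatives serves as a notion of infinite
  differentiability: all iterated partial derivatives exist, and showing that a concrete function is
  smooth reduces to exhibiting such a class.\<close>

definition derivative_closed :: "((real ^ 2) \<times> (real ^ 2) \<Rightarrow> real) set \<Rightarrow> bool" where
  "derivative_closed S \<longleftrightarrow>
     (\<forall>F\<in>S. \<exists>D. (\<forall>v. D v \<in> S) \<and>
        (\<forall>z\<in>unit_square \<times> unit_square. (F has_derivative (\<lambda>v. D v z)) (at z)))"

text \<open>\<open>f\<close> may behave arbitrarily off the squares: it only has to agree on them
  with some \<open>F\<close> that has a full derivative even at boundary points. One-sided partials
  cannot detect more than that.\<close>

definition smooth_kernel :: "(real ^ 2 \<Rightarrow> real ^ 2 \<Rightarrow> real) \<Rightarrow> bool" where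
  "smooth_kernel f \<longleftrightarrow>
     (\<exists>S F. derivative_closed S \<and> F \<in> S \<and> (\<forall>x\<in>unit_square. \<forall>p\<in>unit_square. f x p = F (x, p)))"

lemma derivative_closedE:
  assumes "derivative_closed S" "F \<in> S"
  obtains D where "\<And>v. D v \<in> S"
    "\<And>z. z \<in> unit_square \<times> unit_square \<Longrightarrow> (F has_derivative (\<lambda>v. D v z)) (at z)"
proof -
  from bspec[OF assms(1)[unfolded derivative_closed_def] assms(2)]
  show thesis by (elim exE conjE) (rule that, auto)
qed

lemma smooth_kernelE:
  assumes "smooth_kernel f"
  obtains S F where "derivative_closed S" "F \<in> S"
    "\<And>x p. x \<in> unit_square \<Longrightarrow> p \<in> unit_square \<Longrightarrow> f x p = F (x, p)"
proof -
  from assms[unfolded smooth_kernel_def]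
  show thesis by (elim exE conjE) (rule that, auto)
qed

lemma smooth_kernelI:
  assumes "derivative_closed S" "F \<in> S"
    "\<And>x p. x \<in> unit_square \<Longrightarrow> p \<in> unit_square \<Longrightarrow> f x p = F (x, p)"
  shows "smooth_kernel f"
  unfolding smooth_kernel_def by (intro exI[of _ S] exI[of _ F] conjI ballI assms)

section \<open>Partial derivatives as one-variable derivatives along coordinate slices\<close>

definition upd :: "real ^ 2 \<Rightarrow> 2 \<Rightarrow> real \<Rightarrow> real ^ 2" where
  "upd x m t = (\<chi> l. if l = m then t else x $ l)"

lemma upd_nth [simp]: "upd x m t $ l = (if l = m then t else x $ l)"
  by (simp add: upd_def)

lemma mem_unit_square: "x \<in> unit_square \<longleftrightarrow> (\<forall>i. x $ i \<in> {0..1})"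
  by (auto simp: mem_box_cart)

lemma upd_in_unit_square: "x \<in> unit_square \<Longrightarrow> t \<in> {0..1} \<Longrightarrow> upd x m t \<in> unit_square"
  by (auto simp: mem_box_cart)

lemma upd_self [simp]: "upd x m (x $ m) = x"
  by (simp add: vec_eq_iff)

lemma upd_upd [simp]: "upd (upd x m s) m t = upd x m t"
  by (simp add: vec_eq_iff)

lemma has_vector_derivative_upd:
  "(upd x m has_vector_derivative axis m 1) (at t within T)"
proof -
  have eq: "upd x m = (\<lambda>t. upd x m 0 + t *\<^sub>R axis m 1)"
    by (auto simp: fun_eq_iff vec_eq_iff axis_def)
  show ?thesis
    by (subst eq) (auto intro!: derivative_eq_intros simp: has_vector_derivative_def)
qed

text \<open>The interval is nondegenerate, so a derivative within it is unique at the endpoints too;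
  this pins down the choice hidden in \<open>vector_derivative\<close>.\<close>

lemma vector_derivative_unit_interval:
  fixes f :: "real \<Rightarrow> real"
  assumes "(f has_vector_derivative d) (at t within {0..1})" "t \<in> {0..1}"
  shows "vector_derivative f (at t within {0..1}) = d"
  using vector_derivative_within_closed_interval[OF _ assms(2,1)] by simp

lemma DERIV_unit_interval_unique:
  fixes f :: "real \<Rightarrow> real"
  assumes "(f has_real_derivative d) (at t within {0..1})"
    "(f has_real_derivative e) (at t within {0..1})" "t \<in> {0..1}"
  shows "d = e"
  using vector_derivative_unit_interval[of f _ t] assms
  unfolding has_real_derivative_iff_has_vector_derivative by blast

text \<open>Precomposing a whole class with \<open>prod.swap\<close> keeps it closed under
  derivatives. Facts about \<open>x\<close>-partials thus pass to \<open>p\<close>-partials, and the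
  two boxes can later exchange roles.\<close>

lemma smooth_kernel_swap:
  assumes "smooth_kernel f"
  shows "smooth_kernel (\<lambda>p x. f x p)"
proof -
  obtain S F where S: "derivative_closed S" and F: "F \<in> S"
    "\<And>x p. x \<in> unit_square \<Longrightarrow> p \<in> unit_square \<Longrightarrow> f x p = F (x, p)"
    using smooth_kernelE[OF assms] by metis
  define S' where "S' = (\<lambda>F. F \<circ> prod.swap) ` S"
  have "derivative_closed S'"
    unfolding derivative_closed_def
  proof
    fix F assume "F \<in> S'"
    then obtain G where G: "G \<in> S" "F = G \<circ> prod.swap"
      unfolding S'_def by (rule imageE)
    obtain D where D: "\<And>v. D v \<in> S"
      "\<And>z. z \<in> unit_square \<times> unit_square \<Longrightarrow> (G has_derivative (\<lambda>v. D v z)) (at z)"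
      using derivative_closedE[OF S G(1)] by metis
    have "(F has_derivative (\<lambda>v. (D (prod.swap v) \<circ> prod.swap) z)) (at z)"
      if "z \<in> unit_square \<times> unit_square" for z
    proof -
      have "(prod.swap has_derivative prod.swap) (at z)"
        unfolding prod.swap_def[abs_def] by (auto intro!: derivative_eq_intros)
      from has_derivative_compose[OF this D(2)[of "prod.swap z"]] show ?thesis
        using that unfolding G(2) by (auto simp: o_def)
    qed
    moreover have "D (prod.swap v) \<circ> prod.swap \<in> S'" for v
      unfolding S'_def using D(1) by (rule imageI)
    ultimately show "\<exists>D. (\<forall>v. D v \<in> S') \<and>
        (\<forall>z\<in>unit_square \<times> unit_square. (F has_derivative (\<lambda>v. D v z)) (at z))"
      by (intro exI[of _ "\<lambda>v. D (prod.swap v) \<circ> prod.swap"]) simp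
  qed
  moreover have "F \<circ> prod.swap \<in> S'"
    unfolding S'_def using F(1) by (rule imageI)
  ultimately show ?thesis
    by (rule smooth_kernelI) (simp add: F(2))
qed

lemma partial_p_swap: "partial_p m f x p = partial_x m (\<lambda>p x. f x p) p x"
  by (simp add: partial_x_def partial_p_def)

lemma smooth_kernel_continuous_on:
  assumes "smooth_kernel f"
  shows "continuous_on (unit_square \<times> unit_square) (\<lambda>(x, p). f x p)"
proof -
  obtain S F where S: "derivative_closed S" "F \<in> S" and
    F: "\<And>x p. x \<in> unit_square \<Longrightarrow> p \<in> unit_square \<Longrightarrow> f x p = F (x, p)"
    using smooth_kernelE[OF assms] by metis
  obtain D where D: "\<And>z. z \<in> unit_square \<times> unit_square \<Longrightarrow> (F has_derivative (\<lambda>v. D v z)) (at z)"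
    using derivative_closedE[OF S] by metis
  from D have "continuous_on (unit_square \<times> unit_square) F"
    by (meson continuous_at_imp_continuous_on has_derivative_continuous)
  then show ?thesis
    by (rule continuous_on_eq) (auto simp: F)
qed

text \<open>On the squares the partial derivative is the directional derivative along
  \<open>(axis m 1, 0)\<close>, which lies in the same class \<open>S\<close>, so \<open>S\<close>
  witnesses its smoothness again. Both conclusions rest on this identification and are therefore
  proved together.\<close>

lemma smooth_kernel_partial_x_aux:
  assumes "smooth_kernel f"
  shows "smooth_kernel (partial_x m f) \<and>
    (\<forall>x\<in>unit_square. \<forall>p\<in>unit_square.
      ((\<lambda>t. f (upd x m t) p) has_vector_derivative partial_x m f x p) (at (x $ m) within {0..1}))"
proof -
  obtain S F where S: "derivative_closed S" and F: "F \<in> S"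
    "\<And>x p. x \<in> unit_square \<Longrightarrow> p \<in> unit_square \<Longrightarrow> f x p = F (x, p)"
    using smooth_kernelE[OF assms] by metis
  obtain D where D: "\<And>v. D v \<in> S"
      "\<And>z. z \<in> unit_square \<times> unit_square \<Longrightarrow> (F has_derivative (\<lambda>v. D v z)) (at z)"
    using derivative_closedE[OF S F(1)] by metis
  have *: "((\<lambda>t. f (upd x m t) p) has_vector_derivative D (axis m 1, 0) (x, p))
       (at (x $ m) within {0..1})" if x: "x \<in> unit_square" and p: "p \<in> unit_square" for x p
  proof -
    have xm: "x $ m \<in> {0..1}"
      using x by (simp add: mem_unit_square)
    have "((\<lambda>t. (upd x m t, p)) has_vector_derivative (axis m 1, 0)) (at (x $ m) within {0..1})"
      by (intro has_vector_derivative_Pair has_vector_derivative_upd has_vector_derivative_const)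
    from vector_derivative_diff_chain_within[OF this, of F "\<lambda>v. D v (x, p)"]
    have "((\<lambda>t. F (upd x m t, p)) has_vector_derivative D (axis m 1, 0) (x, p))
       (at (x $ m) within {0..1})"
      using D(2)[of "(x, p)"] x p by (simp add: o_def has_derivative_at_withinI)
    then show ?thesis
      by (rule has_vector_derivative_transform[OF xm, rotated])
         (use F(2) x p in \<open>auto simp: upd_in_unit_square\<close>)
  qed
  have eq: "partial_x m f x p = D (axis m 1, 0) (x, p)"
    if x: "x \<in> unit_square" and p: "p \<in> unit_square" for x p
    unfolding partial_x_def
    using vector_derivative_unit_interval[OF *[OF that]] x by (simp add: mem_unit_square upd_def)
  have "smooth_kernel (partial_x m f)"
    using S D(1) eq by (rule smooth_kernelI)
  with * eq show ?thesis by simp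
qed

lemma smooth_kernel_partial_x: "smooth_kernel f \<Longrightarrow> smooth_kernel (partial_x m f)"
  using smooth_kernel_partial_x_aux by blast

lemma smooth_kernel_partial_p:
  assumes "smooth_kernel f"
  shows "smooth_kernel (partial_p m f)"
proof -
  have "partial_p m f = (\<lambda>x p. partial_x m (\<lambda>p x. f x p) p x)"
    by (intro ext) (rule partial_p_swap)
  then show ?thesis
    using smooth_kernel_swap[OF smooth_kernel_partial_x[OF smooth_kernel_swap[OF assms]]]
    by simp
qed

lemma has_derivative_partial_x:
  assumes "smooth_kernel f" "x \<in> unit_square" "p \<in> unit_square" "t \<in> {0..1}"
  shows "((\<lambda>t. f (upd x m t) p) has_real_derivative partial_x m f (upd x m t) p) (at t within {0..1})"
  using bspec[OF bspec[OF conjunct2[OF smooth_kernel_partial_x_aux[OF assms(1), of m]]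
      upd_in_unit_square[OF assms(2,4), of m]] assms(3)]
  by (simp add: has_real_derivative_iff_has_vector_derivative)

lemma has_derivative_partial_p:
  assumes "smooth_kernel f" "x \<in> unit_square" "p \<in> unit_square" "t \<in> {0..1}"
  shows "((\<lambda>t. f x (upd p m t)) has_real_derivative partial_p m f x (upd p m t)) (at t within {0..1})"
  using has_derivative_partial_x[OF smooth_kernel_swap[OF assms(1)] assms(3,2,4)]
  by (simp add: partial_p_swap)

text \<open>Commutation of partials holds on the squares only, so it cannot be rewritten as an
  equality of functions underneath further derivatives. This congruence replaces such
  rewriting.\<close>

lemma partial_x_cong:
  assumes "\<And>x p. x \<in> unit_square \<Longrightarrow> p \<in> unit_square \<Longrightarrow> f x p = g x p" "smooth_kernel g"
    and x: "x \<in> unit_square" and p: "p \<in> unit_square"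
  shows "partial_x m f x p = partial_x m g x p"
proof -
  have xm: "x $ m \<in> {0..1}"
    using x by (simp add: mem_unit_square)
  have "((\<lambda>t. g (upd x m t) p) has_vector_derivative partial_x m g x p) (at (x $ m) within {0..1})"
    using smooth_kernel_partial_x_aux[OF assms(2)] x p by blast
  then have "((\<lambda>t. f (upd x m t) p) has_vector_derivative partial_x m g x p) (at (x $ m) within {0..1})"
    by (rule has_vector_derivative_transform[OF xm, rotated])
       (use assms(1) x p in \<open>auto simp: upd_in_unit_square\<close>)
  from vector_derivative_unit_interval[OF this xm] show ?thesis
    by (simp add: partial_x_def upd_def)
qed

text \<open>Write \<open>h s t - h s 0\<close> as the integral of \<open>ht s\<close>, differentiate
  under the integral sign in \<open>s\<close>, then differentiate the resulting integral of
  \<open>hst s\<close> in its upper limit. Both differentiations use the continuity of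
  \<open>hst\<close>, and both work with one-sided derivatives on the boundary.\<close>

lemma mixed_derivatives_commute:
  fixes h hs ht hst hts :: "real \<Rightarrow> real \<Rightarrow> real"
  assumes hs: "\<And>s t. s \<in> {0..1} \<Longrightarrow> t \<in> {0..1} \<Longrightarrow>
      ((\<lambda>s. h s t) has_real_derivative hs s t) (at s within {0..1})"
    and ht: "\<And>s t. s \<in> {0..1} \<Longrightarrow> t \<in> {0..1} \<Longrightarrow>
      ((\<lambda>t. h s t) has_real_derivative ht s t) (at t within {0..1})"
    and hst: "\<And>s t. s \<in> {0..1} \<Longrightarrow> t \<in> {0..1} \<Longrightarrow>
      ((\<lambda>s. ht s t) has_real_derivative hst s t) (at s within {0..1})"
    and hts: "\<And>s t. s \<in> {0..1} \<Longrightarrow> t \<in> {0..1} \<Longrightarrow>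
      ((\<lambda>t. hs s t) has_real_derivative hts s t) (at t within {0..1})"
    and cont: "continuous_on ({0..1} \<times> {0..1}) (\<lambda>(s, t). hst s t)"
    and s: "s \<in> {0..1}" and t: "t \<in> {0..1}"
  shows "hst s t = hts s t"
proof -
  have ftc: "(ht s has_integral h s t - h s 0) {0..t}" if "s \<in> {0..1}" "t \<in> {0..1}" for s t
  proof (rule fundamental_theorem_of_calculus)
    show "(h s has_vector_derivative ht s u) (at u within {0..t})" if "u \<in> {0..t}" for u
      using ht[of s u] that \<open>s \<in> {0..1}\<close> \<open>t \<in> {0..1}\<close>
      by (auto simp: has_real_derivative_iff_has_vector_derivative
               intro: has_vector_derivative_within_subset)
  qed (use that in auto)
  have diff_hs: "hs s t - hs s 0 = integral {0..t} (hst s)" if "t \<in> {0..1}" for t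
  proof -
    have "((\<lambda>s. integral (cbox 0 t) (ht s)) has_field_derivative integral (cbox 0 t) (hst s))
        (at s within {0..1})"
    proof (rule leibniz_rule_field_derivative)
      show "continuous_on ({0..1} \<times> cbox 0 t) (\<lambda>(s, t). hst s t)"
        by (rule continuous_on_subset[OF cont]) (use that in auto)
      show "ht s integrable_on cbox 0 t" if "s \<in> {0..1}" for s
        using ftc[OF that \<open>t \<in> {0..1}\<close>] by (auto intro: has_integral_integrable)
    qed (use that s in \<open>auto intro!: hst\<close>)
    moreover have "((\<lambda>s. h s t - h s 0) has_field_derivative hs s t - hs s 0) (at s within {0..1})"
      using that s by (intro DERIV_diff hs) auto
    then have "((\<lambda>s. integral (cbox 0 t) (ht s)) has_field_derivative hs s t - hs s 0)
        (at s within {0..1})"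
      unfolding has_real_derivative_iff_has_vector_derivative
      by (rule has_vector_derivative_transform[OF s, rotated])
         (use ftc[OF _ that] in \<open>auto simp: integral_unique\<close>)
    ultimately show ?thesis
      using DERIV_unit_interval_unique[OF _ _ s] by fastforce
  qed
  have "continuous_on {0..1} (\<lambda>t. (s, t))"
    by (intro continuous_on_Pair continuous_on_const continuous_on_id)
  from continuous_on_compose2[OF cont this] have "continuous_on {0..1} (hst s)"
    using s by (auto simp: image_subset_iff)
  from integral_has_real_derivative[OF this t]
  have "((\<lambda>t. hs s t - hs s 0) has_real_derivative hst s t) (at t within {0..1})"
    unfolding has_real_derivative_iff_has_vector_derivative
    by (rule has_vector_derivative_transform[OF t, rotated]) (use diff_hs in auto)
  moreover have "((\<lambda>t. hs s t - hs s 0) has_real_derivative hts s t - 0) (at t within {0..1})"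
    using hts[OF s t] by (intro DERIV_diff) auto
  ultimately show ?thesis
    using DERIV_unit_interval_unique[OF _ _ t] by fastforce
qed

lemma partial_x_partial_p_commute:
  assumes f: "smooth_kernel f" and x: "x \<in> unit_square" and p: "p \<in> unit_square"
  shows "partial_x m (partial_p l f) x p = partial_p l (partial_x m f) x p"
proof -
  note sk = smooth_kernel_partial_x smooth_kernel_partial_p
  have "continuous_on ({0..1} \<times> {0..1})
      (\<lambda>(s, t). partial_x m (partial_p l f) (upd x m s) (upd p l t))"
  proof -
    have upd_cont: "continuous_on UNIV (upd y k)" for y k
      by (rule continuous_on_vector_derivative[OF has_vector_derivative_upd])
    have "continuous_on ({0..1} \<times> {0..1}) (\<lambda>z. (upd x m (fst z), upd p l (snd z)))"
      by (intro continuous_on_Pair continuous_on_compose2[OF upd_cont] continuous_on_fst continuous_on_snd continuous_on_id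
            subset_UNIV)
    from continuous_on_compose2[OF smooth_kernel_continuous_on this, of "partial_x m (partial_p l f)"]
    show ?thesis
      using f x p by (auto simp: sk upd_in_unit_square case_prod_unfold image_subset_iff)
  qed
  \<comment> \<open>The slice parameters are the coordinates of \<open>x\<close> and
    \<open>p\<close> themselves, where \<open>upd\<close> returns the original points.\<close>
  then have "partial_x m (partial_p l f) (upd x m (x $ m)) (upd p l (p $ l))
      = partial_p l (partial_x m f) (upd x m (x $ m)) (upd p l (p $ l))"
    by (intro mixed_derivatives_commute[where h = "\<lambda>s t. f (upd x m s) (upd p l t)"
          and ht = "\<lambda>s t. partial_p l f (upd x m s) (upd p l t)"
          and hst = "\<lambda>s t. partial_x m (partial_p l f) (upd x m s) (upd p l t)"
          and hs = "\<lambda>s t. partial_x m f (upd x m s) (upd p l t)"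
          and hts = "\<lambda>s t. partial_p l (partial_x m f) (upd x m s) (upd p l t)"]
        has_derivative_partial_x has_derivative_partial_p sk f)
      (use x p in \<open>auto simp: upd_in_unit_square mem_unit_square\<close>)
  then show ?thesis by simp
qed

lemma smooth_kernel_iterated_partials:
  assumes "smooth_kernel f"
  shows "smooth_kernel ((partial_x m ^^ a) f)" "smooth_kernel ((partial_p m ^^ a) f)"
  using assms by (induction a) (auto intro: smooth_kernel_partial_x smooth_kernel_partial_p)

lemma iterated_partial_x_partial_p_commute:
  assumes f: "smooth_kernel f" and "x \<in> unit_square" "p \<in> unit_square"
  shows "(partial_x m ^^ a) (partial_p l f) x p = partial_p l ((partial_x m ^^ a) f) x p"
  using assms(2,3)
proof (induction a arbitrary: x p)
  case (Suc a)
  have "partial_x m ((partial_x m ^^ a) (partial_p l f)) x p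
      = partial_x m (partial_p l ((partial_x m ^^ a) f)) x p"
    using Suc f by (intro partial_x_cong)
      (auto intro: smooth_kernel_partial_p smooth_kernel_iterated_partials)
  then show ?case
    using Suc f by (simp add: partial_x_partial_p_commute smooth_kernel_iterated_partials)
qed simp

lemma iterated_partial_x_cong:
  assumes "\<And>x p. x \<in> unit_square \<Longrightarrow> p \<in> unit_square \<Longrightarrow> f x p = g x p" "smooth_kernel g"
    and "x \<in> unit_square" "p \<in> unit_square"
  shows "(partial_x m ^^ a) f x p = (partial_x m ^^ a) g x p"
  using assms(3,4)
proof (induction a arbitrary: x p)
  case (Suc a)
  then show ?case
    using partial_x_cong[of "(partial_x m ^^ a) f" "(partial_x m ^^ a) g" x p m]
      smooth_kernel_iterated_partials(1)[OF assms(2)] by simp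
qed (use assms in simp)

text \<open>The path from \<open>x\<close> to \<open>y\<close> runs through the corner
  \<open>u\<close>, parallel to the axes and inside the square, so bounds on single partials
  suffice; hence the sum of coordinate distances.\<close>

lemma smooth_kernel_lipschitz:
  assumes f: "smooth_kernel f" and p: "p \<in> unit_square"
    and "\<And>m x. x \<in> unit_square \<Longrightarrow> \<bar>partial_x m f x p\<bar> \<le> B"
    and x: "x \<in> unit_square" and y: "y \<in> unit_square"
  shows "\<bar>f x p - f y p\<bar> \<le> B * (\<bar>x $ 1 - y $ 1\<bar> + \<bar>x $ 2 - y $ 2\<bar>)"
proof -
  have step: "\<bar>f (upd u m s) p - f (upd u m t) p\<bar> \<le> B * \<bar>s - t\<bar>"
    if "u \<in> unit_square" "s \<in> {0..1}" "t \<in> {0..1}" for u m s t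
    using field_differentiable_bound[of "{0..1}" "\<lambda>t. f (upd u m t) p" "\<lambda>t. partial_x m f (upd u m t) p" B s t]
      has_derivative_partial_x[OF f that(1) p] assms(3) upd_in_unit_square[OF that(1)] that
    by (simp add: real_norm_def)
  define u where "u = upd x 1 (y $ 1)"
  have u: "u \<in> unit_square"
    unfolding u_def using x y by (intro upd_in_unit_square) (auto simp: mem_unit_square)
  have "y = upd u 2 (y $ 2)" "u = upd u 2 (x $ 2)"
    by (auto simp: u_def vec_eq_iff forall_2)
  then have "\<bar>f u p - f y p\<bar> \<le> B * \<bar>x $ 2 - y $ 2\<bar>"
    using step[OF u, of "x $ 2" "y $ 2" 2] x y by (metis mem_unit_square)
  moreover have "\<bar>f x p - f u p\<bar> \<le> B * \<bar>x $ 1 - y $ 1\<bar>"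
    using step[OF x, of "x $ 1" "y $ 1" 1] x y by (simp add: mem_unit_square u_def)
  ultimately show ?thesis
    by (simp add: distrib_left)
qed

section \<open>Smoothness of the phase\<close>

definition direction :: "real ^ 2 \<Rightarrow> real ^ 2" where
  "direction p = vector [cos (2 * pi * p $ 2), sin (2 * pi * p $ 2)]"

text \<open>The phase is smooth only away from \<open>k = 0\<close>, so the composition with
  \<open>direction\<close> must avoid the origin.\<close>

lemma direction_nonzero: "direction p \<noteq> 0"
proof
  assume "direction p = 0"
  then have "direction p $ 1 = 0" "direction p $ 2 = 0" by simp_all
  then have "cos (2 * pi * p $ 2) = 0" "sin (2 * pi * p $ 2) = 0"
    by (simp_all add: direction_def)
  then show False
    using sin_cos_squared_add[of "2 * pi * p $ 2"] by simp
qed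

lemma has_derivative_vec_nth [derivative_intros]:
  "(f has_derivative f') F \<Longrightarrow> ((\<lambda>x. f x $ i) has_derivative (\<lambda>x. f' x $ i)) F"
  by (rule bounded_linear.has_derivative[OF bounded_linear_vec_nth])

lemma has_derivative_direction:
  "(direction has_derivative
     (\<lambda>v. - (2 * pi * v $ 2 * sin (2 * pi * p $ 2)) *\<^sub>R axis 1 1
          + (2 * pi * v $ 2 * cos (2 * pi * p $ 2)) *\<^sub>R axis 2 1)) (at p)"
proof -
  have eq: "direction = (\<lambda>p. cos (2 * pi * p $ 2) *\<^sub>R axis 1 1 + sin (2 * pi * p $ 2) *\<^sub>R axis 2 1)"
    by (auto simp: direction_def fun_eq_iff vec_eq_iff forall_2 axis_def)
  show ?thesis
    by (subst eq) (auto intro!: derivative_eq_intros simp: algebra_simps)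
qed

text \<open>Differentiating \<open>g (x, direction p)\<close> produces pullbacks of derivatives of
  \<open>g\<close>, times sines and cosines of \<open>2 * pi * p $ 2\<close>. The generators
  \<open>cos\<close> and \<open>sin\<close> close the class under this, and \<open>p1\<close>
  supplies the remaining factor of \<open>Psi\<close>.\<close>

inductive_set pullbacks :: "((real ^ 2) \<times> (real ^ 2)) set \<Rightarrow> ((real ^ 2) \<times> (real ^ 2) \<Rightarrow> real) set"
  for U where
  base: "(\<And>n. Ck_on n U g) \<Longrightarrow> (\<lambda>z. g (fst z, direction (snd z))) \<in> pullbacks U"
| const: "(\<lambda>z. c) \<in> pullbacks U"
| p1: "(\<lambda>z. snd z $ 1) \<in> pullbacks U"
| cos: "(\<lambda>z. cos (2 * pi * snd z $ 2)) \<in> pullbacks U"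
| sin: "(\<lambda>z. sin (2 * pi * snd z $ 2)) \<in> pullbacks U"
| add: "f \<in> pullbacks U \<Longrightarrow> g \<in> pullbacks U \<Longrightarrow> (\<lambda>z. f z + g z) \<in> pullbacks U"
| mult: "f \<in> pullbacks U \<Longrightarrow> g \<in> pullbacks U \<Longrightarrow> (\<lambda>z. f z * g z) \<in> pullbacks U"

lemmas pullbacks_algebra =
  pullbacks.const pullbacks.p1 pullbacks.cos pullbacks.sin pullbacks.add pullbacks.mult

lemma pullbacks_sum:
  "finite I \<Longrightarrow> (\<And>i. i \<in> I \<Longrightarrow> f i \<in> pullbacks U) \<Longrightarrow> (\<lambda>z. \<Sum>i\<in>I. f i z) \<in> pullbacks U"
  by (induction I rule: finite_induct) (simp_all add: pullbacks.const pullbacks.add)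

lemma pullbacks_derivative:
  assumes "open U" "F \<in> pullbacks U"
  shows "\<exists>D. (\<forall>v. D v \<in> pullbacks U) \<and>
     (\<forall>z. (fst z, direction (snd z)) \<in> U \<longrightarrow> (F has_derivative (\<lambda>v. D v z)) (at z))"
  using assms(2)
proof induction
  case (base g)
  define \<zeta> where "\<zeta> z = (fst z, direction (snd z))" for z :: "(real ^ 2) \<times> (real ^ 2)"
  \<comment> \<open>\<open>Ck_on\<close> speaks of derivatives along basis vectors only, so the
    derivative along a fixed \<open>u\<close> is assembled from those.\<close>
  define E where "E u z = (\<Sum>b\<in>Basis. (u \<bullet> b) * frechet_derivative g (at (\<zeta> z)) b)"
    for u :: "(real ^ 2) \<times> (real ^ 2)" and z
  \<comment> \<open>The chain rule asks for the derivative of \<open>g\<close> along a vector that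
    varies with \<open>z\<close>. Splitting this vector by linearity leaves directions independent
    of \<open>z\<close>, with sine and cosine as separate factors from the class.\<close>
  define D where "D v z = E (fst v, 0) z
      + (- 2 * pi * snd v $ 2) * sin (2 * pi * snd z $ 2) * E (0, axis 1 1) z
      + (2 * pi * snd v $ 2) * cos (2 * pi * snd z $ 2) * E (0, axis 2 1) z"
    for v :: "(real ^ 2) \<times> (real ^ 2)" and z
  have E: "E u \<in> pullbacks U" for u
  proof -
    have "(\<lambda>z. frechet_derivative g (at (\<zeta> z)) b) \<in> pullbacks U" if "b \<in> Basis" for b
    proof -
      have "Ck_on n U (\<lambda>z. frechet_derivative g (at z) b)" for n
        using base[of "Suc n"] that by simp
      from pullbacks.base[OF this] show ?thesis by (simp add: \<zeta>_def)
    qed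
    then show ?thesis
      unfolding E_def[abs_def]
      by (intro pullbacks_sum finite_Basis pullbacks.mult pullbacks.const)
  qed
  have "D v \<in> pullbacks U" for v
    unfolding D_def[abs_def] by (intro pullbacks_algebra E)
  moreover have "((\<lambda>z. g (fst z, direction (snd z))) has_derivative (\<lambda>v. D v z)) (at z)"
    if "(fst z, direction (snd z)) \<in> U" for z
  proof -
    have "g differentiable_on U"
      using base[of "Suc 0"] by simp
    then have "g differentiable (at (\<zeta> z))"
      using that assms(1) by (simp add: differentiable_on_eq_differentiable_at \<zeta>_def)
    then have g: "(g has_derivative frechet_derivative g (at (\<zeta> z))) (at (\<zeta> z))"
      by (simp add: frechet_derivative_works)
    then have lin: "linear (frechet_derivative g (at (\<zeta> z)))"
      by (rule has_derivative_linear)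
    have E_eq: "E u z = frechet_derivative g (at (\<zeta> z)) u" for u
    proof -
      have "frechet_derivative g (at (\<zeta> z)) u
          = frechet_derivative g (at (\<zeta> z)) (\<Sum>b\<in>Basis. (u \<bullet> b) *\<^sub>R b)"
        by (simp add: euclidean_representation)
      also have "\<dots> = E u z"
        by (simp add: E_def linear_sum[OF lin] linear_cmul[OF lin])
      finally show ?thesis by simp
    qed
    have "(\<zeta> has_derivative (\<lambda>v. (fst v, - (2 * pi * snd v $ 2 * sin (2 * pi * snd z $ 2)) *\<^sub>R axis 1 1
          + (2 * pi * snd v $ 2 * cos (2 * pi * snd z $ 2)) *\<^sub>R axis 2 1))) (at z)"
      unfolding \<zeta>_def[abs_def]
      by (intro has_derivative_Pair has_derivative_fst has_derivative_ident
            has_derivative_compose[OF has_derivative_snd[OF has_derivative_ident]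
              has_derivative_direction])
    from has_derivative_compose[OF this g]
    have "((\<lambda>z. g (\<zeta> z)) has_derivative (\<lambda>v. frechet_derivative g (at (\<zeta> z))
        (fst v, - (2 * pi * snd v $ 2 * sin (2 * pi * snd z $ 2)) *\<^sub>R axis 1 1
          + (2 * pi * snd v $ 2 * cos (2 * pi * snd z $ 2)) *\<^sub>R axis 2 1))) (at z)" .
    moreover have "frechet_derivative g (at (\<zeta> z))
        (fst v, - (2 * pi * snd v $ 2 * sin (2 * pi * snd z $ 2)) *\<^sub>R axis 1 1
          + (2 * pi * snd v $ 2 * cos (2 * pi * snd z $ 2)) *\<^sub>R axis 2 1) = D v z" for v
    proof -
      have "(fst v, - (2 * pi * snd v $ 2 * sin (2 * pi * snd z $ 2)) *\<^sub>R axis 1 1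
          + (2 * pi * snd v $ 2 * cos (2 * pi * snd z $ 2)) *\<^sub>R axis 2 1)
        = (fst v, 0) + (- (2 * pi * snd v $ 2) * sin (2 * pi * snd z $ 2)) *\<^sub>R (0, axis 1 1)
          + (2 * pi * snd v $ 2 * cos (2 * pi * snd z $ 2)) *\<^sub>R (0 :: real ^ 2, axis 2 1 :: real ^ 2)"
        by simp
      then show ?thesis
        by (simp only: linear_add[OF lin] linear_cmul[OF lin] D_def E_eq) simp
    qed
    ultimately show ?thesis by (simp add: \<zeta>_def)
  qed
  ultimately show ?case by blast
next
  case (const c)
  show ?case
    by (intro exI[of _ "\<lambda>_ _. 0"]) (auto intro: pullbacks.const)
next
  case p1
  show ?case
    by (intro exI[of _ "\<lambda>v _. snd v $ 1"])
      (auto intro!: pullbacks.const derivative_eq_intros)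
next
  case cos
  show ?case
    by (intro exI[of _ "\<lambda>v z. (- 2 * pi * snd v $ 2) * sin (2 * pi * snd z $ 2)"] conjI allI impI
         pullbacks_algebra)
      (auto intro!: derivative_eq_intros)
next
  case sin
  show ?case
    by (intro exI[of _ "\<lambda>v z. (2 * pi * snd v $ 2) * cos (2 * pi * snd z $ 2)"] conjI allI impI
         pullbacks_algebra)
      (auto intro!: derivative_eq_intros)
next
  case (add f g)
  then obtain D E where "\<forall>v. D v \<in> pullbacks U" "\<forall>v. E v \<in> pullbacks U"
    "\<forall>z. (fst z, direction (snd z)) \<in> U \<longrightarrow> (f has_derivative (\<lambda>v. D v z)) (at z)"
    "\<forall>z. (fst z, direction (snd z)) \<in> U \<longrightarrow> (g has_derivative (\<lambda>v. E v z)) (at z)"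
    by blast
  then show ?case
    by (intro exI[of _ "\<lambda>v z. D v z + E v z"])
      (simp add: pullbacks.add has_derivative_add)
next
  case (mult f g)
  then obtain D E where "\<forall>v. D v \<in> pullbacks U" "\<forall>v. E v \<in> pullbacks U"
    "\<forall>z. (fst z, direction (snd z)) \<in> U \<longrightarrow> (f has_derivative (\<lambda>v. D v z)) (at z)"
    "\<forall>z. (fst z, direction (snd z)) \<in> U \<longrightarrow> (g has_derivative (\<lambda>v. E v z)) (at z)"
    by blast
  with mult show ?case
    by (intro exI[of _ "\<lambda>v z. f z * E v z + D v z * g z"] conjI allI impI
        pullbacks.add pullbacks.mult has_derivative_mult) blast+
qed

text \<open>For \<open>x\<close> in the unit square \<open>Psi\<close> is a product of generators of
  \<open>pullbacks U\<close>, and \<open>direction_nonzero\<close> keeps the relevant points inside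
  \<open>U\<close>, where members of the class are differentiable.\<close>

lemma smooth_kernel_Psi:
  assumes "smooth_phase \<Phi>"
  shows "smooth_kernel (Psi \<Phi>)"
proof -
  obtain U g where U: "open U" "unit_square \<times> (UNIV - {0}) \<subseteq> U"
    and g: "\<And>z. z \<in> unit_square \<times> (UNIV - {0}) \<Longrightarrow> g z = (\<lambda>(x, k). \<Phi> x k) z"
    and Ck: "\<And>n. Ck_on n U g"
    using assms unfolding smooth_phase_def smooth_on_def by blast
  have "(\<lambda>z. sqrt 2 / 2 * g (fst z, direction (snd z)) * snd z $ 1) \<in> pullbacks U"
    by (intro pullbacks_algebra pullbacks.base Ck)
  moreover have "Psi \<Phi> x p = sqrt 2 / 2 * g (x, direction p) * p $ 1" if "x \<in> unit_square" for x p
    using g[of "(x, direction p)"] that direction_nonzero[of p]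
    by (simp add: Psi_def direction_def)
  moreover have "derivative_closed (pullbacks U)"
    unfolding derivative_closed_def
  proof
    fix F assume "F \<in> pullbacks U"
    from pullbacks_derivative[OF U(1) this] obtain D where D: "\<forall>v. D v \<in> pullbacks U"
      "\<forall>z. (fst z, direction (snd z)) \<in> U \<longrightarrow> (F has_derivative (\<lambda>v. D v z)) (at z)"
      by (elim exE conjE)
    moreover have "(fst z, direction (snd z)) \<in> U" if "z \<in> unit_square \<times> unit_square" for z
      using that U(2) direction_nonzero by auto
    ultimately show "\<exists>D. (\<forall>v. D v \<in> pullbacks U) \<and>
        (\<forall>z\<in>unit_square \<times> unit_square. (F has_derivative (\<lambda>v. D v z)) (at z))"
      by (intro exI[of _ D] conjI ballI) blast+
  qed
  ultimately show ?thesis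
    by (intro smooth_kernelI[of "pullbacks U"
          "\<lambda>z. sqrt 2 / 2 * g (fst z, direction (snd z)) * snd z $ 1"]) simp_all
qed

section \<open>Taylor expansion in two variables\<close>

text \<open>\<open>field_Taylor\<close> divides by d! and not by (d+1)!, which leaves a factor d + 1
  beside \<rho>^(d+1). Since d + 1 is at most 2^d, the ratio 1/4 absorbs it and still yields 2^-d.
  One power of \<rho> stays outside because it later supplies the side of the box.\<close>

lemma Taylor_remainder_bound:
  fixes M R \<rho> :: real
  assumes M: "0 \<le> M" and R: "0 < R" and \<rho>: "\<rho> = h / R" "\<rho> \<le> 1 / 4"
    and y: "\<bar>y\<bar> \<le> h"
  shows "M * fact (Suc d) / R ^ Suc d * \<bar>y\<bar> ^ Suc d / fact d \<le> M * \<rho> / 2 ^ d"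
proof -
  have \<rho>0: "0 \<le> \<rho>" using \<rho> y R by simp
  have "M * fact (Suc d) / R ^ Suc d * \<bar>y\<bar> ^ Suc d / fact d
      \<le> M * fact (Suc d) / R ^ Suc d * h ^ Suc d / fact d"
    using M R y by (intro divide_right_mono mult_left_mono power_mono) auto
  also have "\<dots> = M * \<rho> * (real (Suc d) * \<rho> ^ d)"
    using R by (simp add: \<rho>(1) power_divide field_simps)
  also have "\<dots> \<le> M * \<rho> * (1 / 2 ^ d)"
  proof (intro mult_left_mono mult_nonneg_nonneg)
    have "real (Suc d) \<le> 2 ^ d"
      by (metis Suc_leI less_exp of_nat_le_iff of_nat_numeral of_nat_power)
    then have "real (Suc d) * \<rho> ^ d \<le> 2 ^ d * (1 / 4) ^ d"
      using \<rho> \<rho>0 by (intro mult_mono power_mono) auto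
    also have "\<dots> = 1 / 2 ^ d"
      by (simp only: power_mult_distrib[symmetric]) (simp add: power_one_over)
    finally show "real (Suc d) * \<rho> ^ d \<le> 1 / 2 ^ d" .
  qed (use M \<rho>0 in auto)
  finally show ?thesis by simp
qed

text \<open>Expand in the second coordinate between \<open>c'\<close> and \<open>p\<close>, then
  each coefficient in the first coordinate between \<open>c\<close> and \<open>c'\<close>. In the
  intended table the partials in coordinate 1 are outermost, so a step in coordinate 2 is available
  at \<open>a = 0\<close> only, which is where it is taken. The first expansion costs one unit
  \<open>M * (h / R) / 2 ^ d\<close> and the second at most two, hence the 3.\<close>

lemma Taylor_unit_square:
  fixes D :: "nat \<Rightarrow> nat \<Rightarrow> real ^ 2 \<Rightarrow> real"
  assumes M: "0 \<le> M" and R: "0 < R" and h: "h / R \<le> 1 / 4"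
    and c: "c \<in> unit_square" and p: "p \<in> unit_square"
    and near: "\<And>i. \<bar>p $ i - c $ i\<bar> \<le> h"
    and D2: "\<And>b q t. q \<in> unit_square \<Longrightarrow> t \<in> {0..1} \<Longrightarrow>
      ((\<lambda>t. D 0 b (upd q 2 t)) has_real_derivative D 0 (Suc b) (upd q 2 t)) (at t within {0..1})"
    and D1: "\<And>a b q t. q \<in> unit_square \<Longrightarrow> t \<in> {0..1} \<Longrightarrow>
      ((\<lambda>t. D a b (upd q 1 t)) has_real_derivative D (Suc a) b (upd q 1 t)) (at t within {0..1})"
    and bound: "\<And>a b q. q \<in> unit_square \<Longrightarrow> \<bar>D a b q\<bar> \<le> M * fact a * fact b / R ^ (a + b)"
  shows "\<bar>D 0 0 p - (\<Sum>b\<le>d. \<Sum>a\<le>d. D a b c * (p $ 1 - c $ 1) ^ a * (p $ 2 - c $ 2) ^ b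
            / (fact a * fact b))\<bar> \<le> 3 * M * (h / R) / 2 ^ d"
proof -
  define \<rho> where "\<rho> = h / R"
  define y1 where "y1 = p $ 1 - c $ 1"
  define y2 where "y2 = p $ 2 - c $ 2"
  define c' where "c' = upd p 2 (c $ 2)"
  have I: "p $ i \<in> {0..1}" "c $ i \<in> {0..1}" for i
    using p c by (auto simp: mem_unit_square)
  have c'_eq: "c' = upd c 1 (p $ 1)"
    by (auto simp: c'_def vec_eq_iff forall_2)
  have y: "\<bar>y1\<bar> \<le> h" "\<bar>y2\<bar> \<le> h"
    using near by (auto simp: y1_def y2_def)
  have \<rho>: "0 \<le> \<rho>" "\<rho> \<le> 1 / 4"
    using h y R by (auto simp: \<rho>_def)
  have "norm (D 0 0 (upd p 2 (p $ 2)) - (\<Sum>b\<le>d. D 0 b (upd p 2 (c $ 2)) * (p $ 2 - c $ 2) ^ b / fact b))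
      \<le> (M * fact (Suc d) / R ^ Suc d) * norm (p $ 2 - c $ 2) ^ Suc d / fact d"
    by (rule field_Taylor[of "{0..1}" d "\<lambda>b t. D 0 b (upd p 2 t)"])
       (use I D2[OF p] bound[OF upd_in_unit_square[OF p, of _ 2], of _ 0 "Suc d"] in \<open>auto simp del: fact_Suc power_Suc\<close>)
  also have "\<dots> \<le> M * \<rho> / 2 ^ d"
    using Taylor_remainder_bound[OF M R \<rho>_def \<rho>(2) y(2)] by (simp add: y2_def)
  finally have 1: "\<bar>D 0 0 p - (\<Sum>b\<le>d. D 0 b c' * y2 ^ b / fact b)\<bar> \<le> M * \<rho> / 2 ^ d"
    by (simp add: c'_def y2_def)
  have 2: "\<bar>D 0 b c' - (\<Sum>a\<le>d. D a b c * y1 ^ a / fact a)\<bar> \<le> M * fact b / R ^ b * \<rho> / 2 ^ d" for b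
  proof -
    have "norm (D 0 b (upd c 1 (p $ 1)) - (\<Sum>a\<le>d. D a b (upd c 1 (c $ 1)) * (p $ 1 - c $ 1) ^ a / fact a))
      \<le> ((M * fact b / R ^ b) * fact (Suc d) / R ^ Suc d) * norm (p $ 1 - c $ 1) ^ Suc d / fact d"
    proof (rule field_Taylor[of "{0..1}" d "\<lambda>a t. D a b (upd c 1 t)"])
      show "norm (D (Suc d) b (upd c 1 t)) \<le> (M * fact b / R ^ b) * fact (Suc d) / R ^ Suc d"
        if "t \<in> {0..1}" for t
      proof -
        have "M * fact (Suc d) * fact b / R ^ (Suc d + b) = (M * fact b / R ^ b) * fact (Suc d) / R ^ Suc d"
          by (simp only: power_add) (simp add: mult_ac del: fact_Suc power_Suc)
        then show ?thesis
          using bound[OF upd_in_unit_square[OF c that, of 1], of "Suc d" b] by (simp only: real_norm_def)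
      qed
    qed (use I D1[OF c] in auto)
    also have "\<dots> \<le> (M * fact b / R ^ b) * \<rho> / 2 ^ d"
      using Taylor_remainder_bound[OF _ R \<rho>_def \<rho>(2) y(1), of "M * fact b / R ^ b"] M R
      by (simp add: y1_def)
    finally show ?thesis by (simp add: c'_eq y1_def)
  qed
  have "\<bar>(\<Sum>b\<le>d. D 0 b c' * y2 ^ b / fact b)
      - (\<Sum>b\<le>d. \<Sum>a\<le>d. D a b c * y1 ^ a * y2 ^ b / (fact a * fact b))\<bar>
    = \<bar>\<Sum>b\<le>d. (D 0 b c' - (\<Sum>a\<le>d. D a b c * y1 ^ a / fact a)) * (y2 ^ b / fact b)\<bar>"
    by (simp add: sum_subtractf left_diff_distrib sum_distrib_right sum_divide_distrib diff_divide_distrib)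
  also have "\<dots> \<le> (\<Sum>b\<le>d. \<bar>(D 0 b c' - (\<Sum>a\<le>d. D a b c * y1 ^ a / fact a)) * (y2 ^ b / fact b)\<bar>)"
    by (rule sum_abs)
  \<comment> \<open>The growth \<open>fact b / R ^ b\<close> of the coefficient errors cancels
    against \<open>h ^ b / fact b\<close>, leaving a geometric series in \<rho>.\<close>
  also have "\<dots> \<le> (\<Sum>b\<le>d. M * \<rho> / 2 ^ d * \<rho> ^ b)"
  proof (rule sum_mono)
    fix b
    have "\<bar>y2\<bar> ^ b / fact b \<le> h ^ b / fact b"
      using y(2) by (intro divide_right_mono power_mono) auto
    then have "\<bar>(D 0 b c' - (\<Sum>a\<le>d. D a b c * y1 ^ a / fact a)) * (y2 ^ b / fact b)\<bar>
        \<le> (M * fact b / R ^ b * \<rho> / 2 ^ d) * (h ^ b / fact b)"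
      unfolding abs_mult abs_divide power_abs
      using 2[of b] M R \<rho> by (intro mult_mono) auto
    also have "\<dots> = M * \<rho> / 2 ^ d * \<rho> ^ b"
      by (simp add: \<rho>_def power_divide mult_ac)
    finally show "\<bar>(D 0 b c' - (\<Sum>a\<le>d. D a b c * y1 ^ a / fact a)) * (y2 ^ b / fact b)\<bar>
        \<le> M * \<rho> / 2 ^ d * \<rho> ^ b" .
  qed
  also have "\<dots> = M * \<rho> / 2 ^ d * (\<Sum>b\<le>d. \<rho> ^ b)"
    by (simp add: sum_distrib_left)
  also have "\<dots> \<le> M * \<rho> / 2 ^ d * 2"
  proof (rule mult_left_mono)
    have "(\<Sum>b\<le>d. \<rho> ^ b) \<le> (\<Sum>b. \<rho> ^ b)"
      using \<rho> by (intro sum_le_suminf summable_geometric) auto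
    also have "\<dots> = 1 / (1 - \<rho>)"
      using \<rho> by (intro suminf_geometric) auto
    also have "\<dots> \<le> 2"
      using \<rho> by (simp add: divide_simps)
    finally show "(\<Sum>b\<le>d. \<rho> ^ b) \<le> 2" .
  qed (use M \<rho> in auto)
  finally have 3: "\<bar>(\<Sum>b\<le>d. D 0 b c' * y2 ^ b / fact b)
      - (\<Sum>b\<le>d. \<Sum>a\<le>d. D a b c * y1 ^ a * y2 ^ b / (fact a * fact b))\<bar> \<le> 2 * (M * \<rho> / 2 ^ d)"
    by (simp add: mult_ac)
  from 1 3 show ?thesis
    unfolding y1_def y2_def \<rho>_def by linarith
qed

section \<open>Polynomials in two variables of bounded degree\<close>

text \<open>The degree is bounded in each variable separately, so the exponents fill a square, which
  can be enumerated by division with remainder.\<close>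

definition bipoly :: "nat \<Rightarrow> (real ^ 2 \<Rightarrow> complex) set" where
  "bipoly n = {f. \<exists>c. \<forall>y. f y = (\<Sum>a\<le>n. \<Sum>b\<le>n. c a b * of_real (y $ 1) ^ a * of_real (y $ 2) ^ b)}"

lemma bipoly_monom:
  assumes "a \<le> n" "b \<le> n"
  shows "(\<lambda>y. of_real (y $ 1) ^ a * of_real (y $ 2) ^ b) \<in> bipoly n"
proof -
  have "(\<Sum>i\<le>n. \<Sum>j\<le>n. (if i = a \<and> j = b then 1 else 0) * u ^ i * v ^ j) = u ^ a * v ^ b"
    for u v :: complex
  proof -
    have "(\<Sum>i\<le>n. \<Sum>j\<le>n. (if i = a \<and> j = b then 1 else 0) * u ^ i * v ^ j)
        = (\<Sum>i\<le>n. \<Sum>j\<le>n. if j = b then (if i = a then u ^ i * v ^ j else 0) else 0)"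
      by (intro sum.cong refl) auto
    also have "\<dots> = u ^ a * v ^ b"
      using assms by (simp add: sum.delta')
    finally show ?thesis .
  qed
  then show ?thesis
    unfolding bipoly_def by (intro CollectI exI[of _ "\<lambda>i j. if i = a \<and> j = b then 1 else 0"]) simp
qed

lemma bipoly_const: "(\<lambda>y. c) \<in> bipoly n" and
  bipoly_scale: "f \<in> bipoly n \<Longrightarrow> (\<lambda>y. c * f y) \<in> bipoly n"
proof -
  show *: "f \<in> bipoly n \<Longrightarrow> (\<lambda>y. c * f y) \<in> bipoly n" for f c
    unfolding bipoly_def
  proof safe
    fix k assume "\<forall>y. f y = (\<Sum>a\<le>n. \<Sum>b\<le>n. k a b * of_real (y $ 1) ^ a * of_real (y $ 2) ^ b)"
    then show "\<exists>k. \<forall>y. c * f y = (\<Sum>a\<le>n. \<Sum>b\<le>n. k a b * of_real (y $ 1) ^ a * of_real (y $ 2) ^ b)"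
      by (intro exI[of _ "\<lambda>a b. c * k a b"]) (simp add: sum_distrib_left mult.assoc)
  qed
  show "(\<lambda>y. c) \<in> bipoly n"
    using *[OF bipoly_monom[of 0 n 0], of c] by simp
qed

lemma bipoly_add: "f \<in> bipoly n \<Longrightarrow> g \<in> bipoly n \<Longrightarrow> (\<lambda>y. f y + g y) \<in> bipoly n"
  unfolding bipoly_def
proof safe
  fix k l
  assume "\<forall>y. f y = (\<Sum>a\<le>n. \<Sum>b\<le>n. k a b * of_real (y $ 1) ^ a * of_real (y $ 2) ^ b)"
    "\<forall>y. g y = (\<Sum>a\<le>n. \<Sum>b\<le>n. l a b * of_real (y $ 1) ^ a * of_real (y $ 2) ^ b)"
  then show "\<exists>k. \<forall>y. f y + g y = (\<Sum>a\<le>n. \<Sum>b\<le>n. k a b * of_real (y $ 1) ^ a * of_real (y $ 2) ^ b)"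
    by (intro exI[of _ "\<lambda>a b. k a b + l a b"]) (simp add: sum.distrib distrib_right)
qed

lemma bipoly_sum:
  "finite I \<Longrightarrow> (\<And>i. i \<in> I \<Longrightarrow> f i \<in> bipoly n) \<Longrightarrow> (\<lambda>y. \<Sum>i\<in>I. f i y) \<in> bipoly n"
  by (induction I rule: finite_induct) (auto intro: bipoly_add bipoly_const)

lemma bipoly_mult:
  assumes "f \<in> bipoly m" "g \<in> bipoly n"
  shows "(\<lambda>y. f y * g y) \<in> bipoly (m + n)"
proof -
  obtain k l where
    f: "\<And>y. f y = (\<Sum>a\<le>m. \<Sum>b\<le>m. k a b * of_real (y $ 1) ^ a * of_real (y $ 2) ^ b)" and
    g: "\<And>y. g y = (\<Sum>a\<le>n. \<Sum>b\<le>n. l a b * of_real (y $ 1) ^ a * of_real (y $ 2) ^ b)"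
    using assms unfolding bipoly_def by blast
  have "(\<lambda>y. f y * g y) = (\<lambda>y. \<Sum>a\<le>m. \<Sum>a'\<le>n. \<Sum>b\<le>m. \<Sum>b'\<le>n.
      (k a b * l a' b') * (of_real (y $ 1) ^ (a + a') * of_real (y $ 2) ^ (b + b')))"
    unfolding f g sum_product
    by (intro ext sum.cong refl) (simp add: power_add mult_ac)
  moreover have "\<dots> \<in> bipoly (m + n)"
    by (intro bipoly_sum bipoly_scale bipoly_monom) auto
  ultimately show ?thesis by simp
qed

text \<open>The constant 1 counts as a polynomial of degree \<open>n - m\<close>; multiplying by it
  pads the degree.\<close>

lemma bipoly_mono:
  assumes "f \<in> bipoly m" "m \<le> n"
  shows "f \<in> bipoly n"
  using bipoly_mult[OF assms(1) bipoly_const[of 1 "n - m"]] assms(2) by simp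

lemma bipoly_power: "f \<in> bipoly n \<Longrightarrow> (\<lambda>y. f y ^ k) \<in> bipoly (k * n)"
  by (induction k) (auto intro: bipoly_const bipoly_mult)

lemma bipoly_exp_truncation:
  assumes "f \<in> bipoly n"
  shows "(\<lambda>y. \<Sum>k\<le>d. f y ^ k / fact k) \<in> bipoly (d * n)"
  using bipoly_scale[OF bipoly_mono[OF bipoly_power[OF assms]], of _ "d * n" "1 / fact _"]
  by (intro bipoly_sum) (simp_all)

text \<open>The exponents are the base \<open>n + 1\<close> digits of \<open>t - 1\<close>; the
  shift reflects that \<open>separated_approx\<close> numbers its terms from 1.\<close>

definition mono_index :: "nat \<Rightarrow> nat \<Rightarrow> nat ^ 2" where
  "mono_index n t = vector [(t - 1) div (n + 1), (t - 1) mod (n + 1)]"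

lemma bipoly_expand:
  assumes "f \<in> bipoly n"
  shows "\<exists>c. \<forall>y. f y = (\<Sum>t=1..(n + 1)\<^sup>2. c t * of_real (mi_power y (mono_index n t)))"
proof -
  obtain k where f: "\<And>y. f y = (\<Sum>a\<le>n. \<Sum>b\<le>n. k a b * of_real (y $ 1) ^ a * of_real (y $ 2) ^ b)"
    using assms unfolding bipoly_def by blast
  define c where "c t = k (mono_index n t $ 1) (mono_index n t $ 2)" for t
  have "f y = (\<Sum>t=1..(n + 1)\<^sup>2. c t * of_real (mi_power y (mono_index n t)))" for y
  proof -
    have "(\<Sum>t=1..(n + 1)\<^sup>2. c t * of_real (mi_power y (mono_index n t)))
        = (\<Sum>(a, b)\<in>{..n} \<times> {..n}. k a b * of_real (y $ 1) ^ a * of_real (y $ 2) ^ b)"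
    proof (rule sum.reindex_bij_witness[where j = "\<lambda>t. ((t - 1) div (n + 1), (t - 1) mod (n + 1))"
          and i = "\<lambda>(a, b). a * (n + 1) + b + 1"])
      fix t assume t: "t \<in> {1..(n + 1)\<^sup>2}"
      then have "(t - 1) div (n + 1) < n + 1"
        by (intro less_mult_imp_div_less) (auto simp: power2_eq_square)
      then show "((t - 1) div (n + 1), (t - 1) mod (n + 1)) \<in> {..n} \<times> {..n}"
        by (auto simp: less_Suc_eq_le[symmetric])
      show "(case ((t - 1) div (n + 1), (t - 1) mod (n + 1)) of (a, b) \<Rightarrow> a * (n + 1) + b + 1) = t"
        using t by (simp only: split div_mult_mod_eq) simp
    next
      fix ab assume "ab \<in> {..n} \<times> {..n}"
      then obtain a b where ab: "ab = (a, b)" "a \<le> n" "b \<le> n" by auto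
      have "a * (n + 1) \<le> n * (n + 1)"
        using ab by (intro mult_right_mono) auto
      then show "(case ab of (a, b) \<Rightarrow> a * (n + 1) + b + 1) \<in> {1..(n + 1)\<^sup>2}"
        using ab by (auto simp: power2_eq_square)
      show "(((case ab of (a, b) \<Rightarrow> a * (n + 1) + b + 1) - 1) div (n + 1),
             ((case ab of (a, b) \<Rightarrow> a * (n + 1) + b + 1) - 1) mod (n + 1)) = ab"
        using ab by (auto simp del: mult_Suc_right simp: div_nat_eqI)
    qed (auto simp: c_def mono_index_def mi_power_def)
    then show ?thesis
      by (simp add: f sum.cartesian_product)
  qed
  then show ?thesis by blast
qed

lemma mi_abs_mono_index:
  assumes "t \<in> {1..(n + 1)\<^sup>2}"
  shows "mi_abs (mono_index n t) \<le> 2 * n"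
proof -
  have "(t - 1) div (n + 1) < n + 1"
    using assms by (intro less_mult_imp_div_less) (auto simp: power2_eq_square)
  moreover have "(t - 1) mod (n + 1) < n + 1"
    by simp
  ultimately show ?thesis
    unfolding mi_abs_def mono_index_def vector_2 by linarith
qed

section \<open>Truncating the exponential\<close>

text \<open>Passing from \<theta> to \<theta>' costs at most the arc between them. In the series
  remainder, (2K)^d equals (4K)^d / 2^d, which gives the factor 2^-d, while (4K)^d / d! is a single
  term of the series of exp (4K).\<close>

lemma cis_truncation_error:
  fixes \<theta> \<theta>' K :: real
  assumes close: "\<bar>\<theta> - \<theta>'\<bar> \<le> K / 2 ^ d" and K: "\<bar>\<theta>'\<bar> \<le> 2 * K"
  shows "cmod (exp (\<i> * of_real \<theta>) - (\<Sum>k\<le>d. (\<i> * of_real \<theta>') ^ k / fact k))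
    \<le> (K + 2 * K * exp (4 * K)) / 2 ^ d"
proof -
  have K0: "0 \<le> K" using K by linarith
  have "cmod (exp (\<i> * of_real \<theta>) - exp (\<i> * of_real \<theta>'))
      = cmod (exp (\<i> * of_real \<theta>') * (exp (\<i> * of_real (\<theta> - \<theta>')) - 1))"
    by (simp add: right_diff_distrib exp_add[symmetric] del: of_real_diff) (simp add: algebra_simps)
  also have "\<dots> = 2 * \<bar>sin ((\<theta> - \<theta>') / 2)\<bar>"
    by (simp only: norm_mult norm_exp_i_times dist_exp_i_1)
  also have "\<dots> \<le> \<bar>\<theta> - \<theta>'\<bar>"
    using abs_sin_x_le_abs_x[of "(\<theta> - \<theta>') / 2"] by simp
  finally have 1: "cmod (exp (\<i> * of_real \<theta>) - exp (\<i> * of_real \<theta>')) \<le> K / 2 ^ d"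
    using close by linarith
  \<comment> \<open>The argument is purely imaginary, so the factor exp |Re z| in
    \<open>Taylor_exp\<close> is 1.\<close>
  have "cmod (exp (\<i> * of_real \<theta>') - (\<Sum>k\<le>d. (\<i> * of_real \<theta>') ^ k / fact k))
      \<le> \<bar>\<theta>'\<bar> ^ Suc d / fact d"
    using Taylor_exp[of "\<i> * of_real \<theta>'" d] by (simp add: norm_mult)
  also have "\<dots> \<le> (2 * K) ^ Suc d / fact d"
    using K by (intro divide_right_mono power_mono) auto
  also have "\<dots> = 2 * K * ((4 * K) ^ d / fact d) / 2 ^ d"
  proof -
    have "(4 * K) ^ d = (2 * K) ^ d * 2 ^ d"
      by (simp only: power_mult_distrib[symmetric]) simp
    then show ?thesis by (simp only: power_Suc) simp
  qed
  also have "\<dots> \<le> 2 * K * exp (4 * K) / 2 ^ d"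
  proof (intro divide_right_mono mult_left_mono)
    have "(4 * K) ^ d / fact d = (\<Sum>n\<in>{d}. (4 * K) ^ n /\<^sub>R fact n)"
      by (simp add: divide_inverse_commute)
    also have "\<dots> \<le> exp (4 * K)"
      unfolding exp_def using K0
      by (intro sum_le_suminf summable_exp_generic) auto
    finally show "(4 * K) ^ d / fact d \<le> exp (4 * K)" .
  qed (use K0 in auto)
  finally have "cmod (exp (\<i> * of_real \<theta>') - (\<Sum>k\<le>d. (\<i> * of_real \<theta>') ^ k / fact k))
      \<le> 2 * K * exp (4 * K) / 2 ^ d" .
  with 1 norm_triangle_ineq[of "exp (\<i> * of_real \<theta>) - exp (\<i> * of_real \<theta>')"
      "exp (\<i> * of_real \<theta>') - (\<Sum>k\<le>d. (\<i> * of_real \<theta>') ^ k / fact k)"]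
  show ?thesis
    by (simp add: add_divide_distrib)
qed

section \<open>Boxes\<close>

lemma width_pos: "0 < width A"
  by (simp add: width_def)

lemma center_in_points: "center A \<in> points A"
  using width_pos[of A] by (auto simp: points_def center_def mem_box_cart algebra_simps)

lemma points_near_center:
  assumes "x \<in> points A"
  shows "\<bar>x $ i - center A $ i\<bar> \<le> width A / 2"
proof -
  have "real (pos A $ i) * width A \<le> x $ i" "x $ i \<le> (real (pos A $ i) + 1) * width A"
    using assms by (auto simp: points_def mem_box_cart)
  moreover have "center A $ i = real (pos A $ i) * width A + width A / 2"
    by (simp add: center_def distrib_right)
  ultimately show ?thesis
    by (simp only: distrib_right abs_le_iff) simp
qed

section \<open>Bounds on the derivatives\<close>

lemma iterated_partial_p_swap:
  "(partial_p m ^^ a) (\<lambda>p x. f x p) = (\<lambda>p x. (partial_x m ^^ a) f x p)"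
  by (induction a) (simp_all add: partial_p_def partial_x_def fun_eq_iff)

text \<open>One \<open>x\<close>-derivative costs a factor 1/R and has factorial 1, whence
  \<open>Q / R\<close>. This bound later serves as a Lipschitz constant.\<close>

lemma analytic_bound_x:
  assumes "analytic_bound Q R f" "x \<in> unit_square" "p \<in> unit_square"
  shows "\<bar>partial_x m ((partial_p 1 ^^ a) ((partial_p 2 ^^ b) f)) x p\<bar>
    \<le> Q / R * fact a * fact b / R ^ (a + b)"
proof -
  have "mixed_partial (axis m 1) (vector [a, b]) f = partial_x m ((partial_p 1 ^^ a) ((partial_p 2 ^^ b) f))"
    using exhaust_2[of m] by (auto simp: mixed_partial_def axis_def)
  moreover have "mi_fact (axis m 1) = 1" "mi_abs (axis m 1) = 1"
    using exhaust_2[of m] by (auto simp: mi_fact_def mi_abs_def axis_def)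
  moreover have "mi_fact (vector [a, b]) = fact a * fact b" "mi_abs (vector [a, b]) = a + b"
    by (simp_all add: mi_fact_def mi_abs_def)
  moreover have "\<bar>mixed_partial (axis m 1) (vector [a, b]) f x p\<bar>
      \<le> Q * real (mi_fact (axis m 1)) * real (mi_fact (vector [a, b]))
          / R ^ (mi_abs (axis m 1) + mi_abs (vector [a, b]))"
    using assms unfolding analytic_bound_def by blast
  ultimately show ?thesis by (simp add: mult_ac)
qed

text \<open>\<open>mixed_partial\<close> applies the \<open>x\<close>-derivatives last, so the outer
  \<open>p\<close>-derivative must be moved inward before \<open>analytic_bound\<close> applies.
  Smoothness of \<open>f\<close> permits this.\<close>

lemma analytic_bound_p:
  assumes "analytic_bound Q R f" "smooth_kernel f" and x: "x \<in> unit_square" and p: "p \<in> unit_square"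
  shows "\<bar>partial_p m ((partial_x 1 ^^ a) ((partial_x 2 ^^ b) f)) x p\<bar>
    \<le> Q / R * fact a * fact b / R ^ (a + b)"
proof -
  note sk = smooth_kernel_iterated_partials smooth_kernel_partial_p assms(2)
  have "mixed_partial (vector [a, b]) (axis m 1) f x p
      = (partial_x 1 ^^ a) ((partial_x 2 ^^ b) (partial_p m f)) x p"
    using exhaust_2[of m] by (auto simp: mixed_partial_def axis_def)
  also have "\<dots> = (partial_x 1 ^^ a) (partial_p m ((partial_x 2 ^^ b) f)) x p"
    using x p by (intro iterated_partial_x_cong iterated_partial_x_partial_p_commute sk)
  also have "\<dots> = partial_p m ((partial_x 1 ^^ a) ((partial_x 2 ^^ b) f)) x p"
    using x p by (intro iterated_partial_x_partial_p_commute sk)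
  finally have "partial_p m ((partial_x 1 ^^ a) ((partial_x 2 ^^ b) f)) x p
      = mixed_partial (vector [a, b]) (axis m 1) f x p" by simp
  moreover have "mi_fact (axis m 1) = 1" "mi_abs (axis m 1) = 1"
    using exhaust_2[of m] by (auto simp: mi_fact_def mi_abs_def axis_def)
  moreover have "mi_fact (vector [a, b]) = fact a * fact b" "mi_abs (vector [a, b]) = a + b"
    by (simp_all add: mi_fact_def mi_abs_def)
  moreover have "\<bar>mixed_partial (vector [a, b]) (axis m 1) f x p\<bar>
      \<le> Q * real (mi_fact (vector [a, b])) * real (mi_fact (axis m 1))
          / R ^ (mi_abs (vector [a, b]) + mi_abs (axis m 1))"
    using assms unfolding analytic_bound_def by blast
  ultimately show ?thesis by (simp add: mult_ac)
qed

section \<open>Separated approximation when the second box is small\<close>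

text \<open>The table \<open>D\<close> holds the \<open>p\<close>-derivatives of the increment of
  \<open>f\<close> from the center of \<open>A\<close> to \<open>x\<close>, so its bounds carry
  w(A), and the Taylor remainder adds w(B). The coefficients \<open>k\<close> are quantified before
  \<open>d\<close> because the same ones are used at order 0, to bound the phase, and at order
  \<open>d\<close>.\<close>

lemma residual_phase_polynomial:
  fixes Q R :: real and N :: nat
  assumes f: "smooth_kernel f" and Q: "0 < Q" and R: "0 < R"
    and bound: "\<And>a b m x p. x \<in> unit_square \<Longrightarrow> p \<in> unit_square \<Longrightarrow>
      \<bar>partial_x m ((partial_p 1 ^^ a) ((partial_p 2 ^^ b) f)) x p\<bar>
        \<le> Q / R * fact a * fact b / R ^ (a + b)"
    and A: "points A \<subseteq> unit_square" and B: "points B \<subseteq> unit_square"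
    and wAB: "real N * width A * width B = 1" and wB: "width B \<le> R / 2"
    and x: "x \<in> points A"
  shows "\<exists>k. \<forall>p\<in>points B. \<forall>d.
      \<bar>2 * pi * N * residual_phase f A B x p
        - 2 * pi * N * ((\<Sum>b\<le>d. \<Sum>a\<le>d. k a b * ((p - center B) $ 1) ^ a * ((p - center B) $ 2) ^ b) - k 0 0)\<bar>
      \<le> 3 * pi * Q / R\<^sup>2 / 2 ^ d"
proof -
  define g where "g a b = (partial_p 1 ^^ a) ((partial_p 2 ^^ b) f)" for a b
  define D where "D a b q = g a b x q - g a b (center A) q" for a b q
  define k where "k a b = D a b (center B) / (fact a * fact b)" for a b
  have sk: "smooth_kernel (g a b)" for a b
    unfolding g_def by (intro smooth_kernel_iterated_partials f)
  have xs: "x \<in> unit_square" "center A \<in> unit_square" "center B \<in> unit_square"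
    using A B x center_in_points by auto
  have g1: "g (Suc a) b = partial_p 1 (g a b)" and g2: "g 0 (Suc b) = partial_p 2 (g 0 b)" for a b
    by (simp_all add: g_def)
  have D_bound: "\<bar>D a b q\<bar> \<le> (Q / R * width A) * fact a * fact b / R ^ (a + b)"
    if q: "q \<in> unit_square" for a b q
  proof -
    define L where "L = Q / R * fact a * fact b / R ^ (a + b)"
    have "\<bar>D a b q\<bar> \<le> L * (\<bar>x $ 1 - center A $ 1\<bar> + \<bar>x $ 2 - center A $ 2\<bar>)"
      unfolding D_def
    proof (rule smooth_kernel_lipschitz[OF sk q])
      show "\<bar>partial_x m (g a b) y q\<bar> \<le> L" if "y \<in> unit_square" for m y
        unfolding g_def L_def by (rule bound[OF that q])
    qed (use xs in auto)
    also have "\<dots> \<le> L * width A"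
    proof (rule mult_left_mono)
      show "\<bar>x $ 1 - center A $ 1\<bar> + \<bar>x $ 2 - center A $ 2\<bar> \<le> width A"
        using points_near_center[OF x, of 1] points_near_center[OF x, of 2] by linarith
      show "0 \<le> L"
        using Q R by (simp add: L_def)
    qed
    finally show ?thesis by (simp add: L_def mult_ac)
  qed
  have main: "\<bar>D 0 0 p - (\<Sum>b\<le>d. \<Sum>a\<le>d. k a b * ((p - center B) $ 1) ^ a * ((p - center B) $ 2) ^ b)\<bar>
      \<le> 3 * (Q / R * width A) * (width B / 2 / R) / 2 ^ d" if p: "p \<in> points B" for p d
  proof -
    have "\<bar>D 0 0 p - (\<Sum>b\<le>d. \<Sum>a\<le>d. D a b (center B) * (p $ 1 - center B $ 1) ^ a
          * (p $ 2 - center B $ 2) ^ b / (fact a * fact b))\<bar>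
        \<le> 3 * (Q / R * width A) * (width B / 2 / R) / 2 ^ d"
    proof (rule Taylor_unit_square)
      show "0 \<le> Q / R * width A" using Q R width_pos[of A] by simp
      show "width B / 2 / R \<le> 1 / 4" using wB R by (simp add: field_simps)
      show "((\<lambda>t. D 0 b (upd q 2 t)) has_real_derivative D 0 (Suc b) (upd q 2 t)) (at t within {0..1})"
        if "q \<in> unit_square" "t \<in> {0..1}" for b q t
        unfolding D_def g2 using that xs by (intro DERIV_diff has_derivative_partial_p sk)
      show "((\<lambda>t. D a b (upd q 1 t)) has_real_derivative D (Suc a) b (upd q 1 t)) (at t within {0..1})"
        if "q \<in> unit_square" "t \<in> {0..1}" for a b q t
        unfolding D_def g1 using that xs by (intro DERIV_diff has_derivative_partial_p sk)
      show "\<bar>p $ i - center B $ i\<bar> \<le> width B / 2" for i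
        by (rule points_near_center[OF p])
    qed (use R p B xs D_bound in auto)
    then show ?thesis by (simp add: k_def)
  qed
  \<comment> \<open>The two terms of the residual at the center of \<open>B\<close> combine to minus
    the constant Taylor coefficient.\<close>
  have res: "residual_phase f A B x p = D 0 0 p - k 0 0" for p
    by (simp add: residual_phase_def D_def k_def g_def)
  \<comment> \<open>The 2 in \<open>2 * pi\<close> cancels against the half side
    \<open>width B / 2\<close>.\<close>
  have const: "2 * pi * N * (3 * (Q / R * width A) * (width B / 2 / R)) = 3 * pi * Q / R\<^sup>2"
  proof -
    have "2 * pi * N * (3 * (Q / R * width A) * (width B / 2 / R))
        = 3 * pi * Q / R\<^sup>2 * (real N * width A * width B)"
      by (simp add: power2_eq_square)
    then show ?thesis by (simp add: wAB)
  qed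
  have "\<bar>2 * pi * N * residual_phase f A B x p
        - 2 * pi * N * ((\<Sum>b\<le>d. \<Sum>a\<le>d. k a b * ((p - center B) $ 1) ^ a * ((p - center B) $ 2) ^ b) - k 0 0)\<bar>
      \<le> 3 * pi * Q / R\<^sup>2 / 2 ^ d" if p: "p \<in> points B" for p d
  proof -
    let ?S = "\<Sum>b\<le>d. \<Sum>a\<le>d. k a b * ((p - center B) $ 1) ^ a * ((p - center B) $ 2) ^ b"
    have "2 * pi * N * residual_phase f A B x p - 2 * pi * N * (?S - k 0 0)
        = 2 * pi * N * (D 0 0 p - ?S)"
      by (simp add: res right_diff_distrib)
    then have "\<bar>2 * pi * N * residual_phase f A B x p - 2 * pi * N * (?S - k 0 0)\<bar>
        = 2 * pi * N * \<bar>D 0 0 p - ?S\<bar>"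
      by (simp only: abs_mult) simp
    also have "\<dots> \<le> 2 * pi * N * (3 * (Q / R * width A) * (width B / 2 / R) / 2 ^ d)"
      using main[OF p] by (intro mult_left_mono) auto
    also have "\<dots> = 3 * pi * Q / R\<^sup>2 / 2 ^ d"
      by (simp only: const[symmetric] times_divide_eq_right)
    finally show ?thesis .
  qed
  then show ?thesis by (intro exI[of _ k] ballI allI)
qed

text \<open>Truncating at order \<open>d\<close> the exponential of a polynomial of degree
  \<open>d\<close> in each variable gives degree \<open>d * d\<close> in each. The monomials do not
  depend on \<open>x\<close>, so the coefficients found separately at each \<open>x\<close> become
  the left factors, with no regularity asked of them.\<close>

lemma separated_approximation:
  fixes Q R K :: real and N d :: nat
  assumes f: "smooth_kernel f" and Q: "0 < Q" and R: "0 < R"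
    and bound: "\<And>a b m x p. x \<in> unit_square \<Longrightarrow> p \<in> unit_square \<Longrightarrow>
      \<bar>partial_x m ((partial_p 1 ^^ a) ((partial_p 2 ^^ b) f)) x p\<bar>
        \<le> Q / R * fact a * fact b / R ^ (a + b)"
    and A: "points A \<subseteq> unit_square" and B: "points B \<subseteq> unit_square"
    and wAB: "real N * width A * width B = 1" and wB: "width B \<le> R / 2"
    and K: "K = 3 * pi * Q / R\<^sup>2"
  shows "\<exists>c. separated_approx f N ((K + 2 * K * exp (4 * K)) / 2 ^ d) A B ((d * d + 1)\<^sup>2) c
    (\<lambda>t p. of_real (mi_power (p - center B) (mono_index (d * d) t)))"
proof -
  have "\<exists>c. \<forall>p\<in>points B.
    cmod (exp (2 * of_real pi * \<i> * of_nat N * of_real (residual_phase f A B x p))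
        - (\<Sum>t=1..(d * d + 1)\<^sup>2. c t * of_real (mi_power (p - center B) (mono_index (d * d) t))))
    \<le> (K + 2 * K * exp (4 * K)) / 2 ^ d" if x: "x \<in> points A" for x
  proof -
    obtain k where k: "\<forall>p\<in>points B. \<forall>d.
      \<bar>2 * pi * N * residual_phase f A B x p
        - 2 * pi * N * ((\<Sum>b\<le>d. \<Sum>a\<le>d. k a b * ((p - center B) $ 1) ^ a * ((p - center B) $ 2) ^ b) - k 0 0)\<bar>
      \<le> K / 2 ^ d"
      unfolding K using residual_phase_polynomial[OF f Q R bound A B wAB wB x] by (rule exE)
    define \<theta> where "\<theta> y = 2 * pi * N * ((\<Sum>b\<le>d. \<Sum>a\<le>d. k a b * (y $ 1) ^ a * (y $ 2) ^ b) - k 0 0)"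
      for y :: "real ^ 2"
    have "(\<lambda>y. \<i> * of_real (\<theta> y)) = (\<lambda>y. (\<i> * of_real (2 * pi * N)) *
        ((\<Sum>b\<le>d. \<Sum>a\<le>d. of_real (k a b) * (of_real (y $ 1) ^ a * of_real (y $ 2) ^ b)) + of_real (- k 0 0)))"
      by (simp add: \<theta>_def fun_eq_iff mult.assoc)
    also have "\<dots> \<in> bipoly d"
      by (intro bipoly_scale bipoly_add bipoly_sum bipoly_const bipoly_monom) auto
    finally have "(\<lambda>y. \<i> * of_real (\<theta> y)) \<in> bipoly d" .
    from bipoly_expand[OF bipoly_exp_truncation[OF this, of d]]
    obtain c where c: "\<forall>y. (\<Sum>j\<le>d. (\<i> * of_real (\<theta> y)) ^ j / fact j)
        = (\<Sum>t=1..(d * d + 1)\<^sup>2. c t * of_real (mi_power y (mono_index (d * d) t)))"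
      by (rule exE)
    have "cmod (exp (2 * of_real pi * \<i> * of_nat N * of_real (residual_phase f A B x p))
        - (\<Sum>t=1..(d * d + 1)\<^sup>2. c t * of_real (mi_power (p - center B) (mono_index (d * d) t))))
      \<le> (K + 2 * K * exp (4 * K)) / 2 ^ d" if p: "p \<in> points B" for p
    proof -
      have close: "\<bar>2 * pi * N * residual_phase f A B x p - \<theta> (p - center B)\<bar> \<le> K / 2 ^ d"
        unfolding \<theta>_def by (rule k[rule_format, OF p])
      text \<open>At truncation order 0 the polynomial phase vanishes.\<close>
      have "\<bar>2 * pi * N * residual_phase f A B x p\<bar> \<le> K"
        using k[rule_format, OF p, of 0] by simp
      moreover have "K / 2 ^ d \<le> K"
        using Q R by (simp add: K divide_le_eq mult_le_cancel_left1)
      ultimately have "\<bar>\<theta> (p - center B)\<bar> \<le> 2 * K"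
        using close by linarith
      from cis_truncation_error[OF close this] show ?thesis
        by (simp add: c[rule_format] mult_ac)
    qed
    then show ?thesis by (intro exI[of _ c] ballI)
  qed
  then have "\<forall>x\<in>points A. \<exists>c. \<forall>p\<in>points B.
    cmod (exp (2 * of_real pi * \<i> * of_nat N * of_real (residual_phase f A B x p))
        - (\<Sum>t=1..(d * d + 1)\<^sup>2. c t * of_real (mi_power (p - center B) (mono_index (d * d) t))))
    \<le> (K + 2 * K * exp (4 * K)) / 2 ^ d" by (rule ballI)
  from bchoice[OF this] obtain c where "\<forall>x\<in>points A. \<forall>p\<in>points B.
    cmod (exp (2 * of_real pi * \<i> * of_nat N * of_real (residual_phase f A B x p))
        - (\<Sum>t=1..(d * d + 1)\<^sup>2. c x t * of_real (mi_power (p - center B) (mono_index (d * d) t))))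
    \<le> (K + 2 * K * exp (4 * K)) / 2 ^ d" by (rule exE)
  then show ?thesis
    unfolding separated_approx_def by (intro exI[of _ "\<lambda>t x. c x t"])
qed

section \<open>Exchange of the variables, admissible monomials and choice of the truncation
  order\<close>

lemma separated_approx_swap:
  assumes "separated_approx (\<lambda>p x. f x p) N e B A r \<beta> \<alpha>"
  shows "separated_approx f N e A B r \<alpha> \<beta>"
proof -
  have "residual_phase (\<lambda>p x. f x p) B A p x = residual_phase f A B x p" for x p
    by (simp add: residual_phase_def)
  then show ?thesis
    using assms by (simp add: separated_approx_def mult.commute)
qed

lemma separated_approx_mono:
  assumes "separated_approx f N e A B r \<alpha> \<beta>" "e \<le> e'"
  shows "separated_approx f N e' A B r \<alpha> \<beta>"
  using assms unfolding separated_approx_def by (meson order_trans)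

lemma centered_monomials_mono_index:
  assumes "real (2 * n) \<le> D"
  shows "centered_monomials A ((n + 1)\<^sup>2) D
    (\<lambda>t y. of_real (mi_power (y - center A) (mono_index n t)))"
  unfolding centered_monomials_def
proof
  fix t assume "t \<in> {1..(n + 1)\<^sup>2}"
  then have "real (mi_abs (mono_index n t)) \<le> D"
    using mi_abs_mono_index[of t n] assms by linarith
  then show "\<exists>k. real (mi_abs k) \<le> D \<and>
      (\<forall>y\<in>points A. of_real (mi_power (y - center A) (mono_index n t))
          = (of_real (mi_power (y - center A) k) :: complex))"
    by blast
qed

text \<open>For eps at most 1/e the logarithm ln (1/eps) is at least 1, so additive constants can be
  absorbed into a multiple of it. This is where the threshold \<open>exp (- 1)\<close> comes
  from.\<close>

lemma truncation_order:
  fixes K :: real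
  assumes K: "0 < K"
  obtains C where "0 < C" and
    "\<And>\<epsilon>. 0 < \<epsilon> \<Longrightarrow> \<epsilon> \<le> exp (- 1) \<Longrightarrow> \<exists>d. K / 2 ^ d \<le> \<epsilon> \<and> real d \<le> C * ln (1 / \<epsilon>)"
proof
  \<comment> \<open>The summands pay for the constant \<open>K\<close>, for the change of base to 2,
    and for rounding up to an integer.\<close>
  define C where "C = \<bar>log 2 K\<bar> + 1 / ln 2 + 1"
  show "0 < C" by (simp add: C_def add_nonneg_pos)
  fix \<epsilon> :: real assume \<epsilon>: "0 < \<epsilon>" "\<epsilon> \<le> exp (- 1)"
  define l where "l = ln (1 / \<epsilon>)"
  have "ln \<epsilon> \<le> ln (exp (- 1))"
    using \<epsilon> by (subst ln_le_cancel_iff) auto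
  then have l: "1 \<le> l"
    using \<epsilon> by (simp add: l_def ln_div)
  define d where "d = nat \<lceil>log 2 (K / \<epsilon>)\<rceil>"
  have "log 2 (K / \<epsilon>) \<le> real d"
    by (simp add: d_def real_nat_ceiling_ge)
  then have "K / \<epsilon> \<le> 2 powr real d"
    using K \<epsilon> by (simp add: log_le_iff)
  then have "K / 2 ^ d \<le> \<epsilon>"
    using \<epsilon> by (simp add: powr_realpow field_simps)
  moreover have "real d \<le> C * l"
  proof -
    have "log 2 (K / \<epsilon>) = log 2 K + l / ln 2"
      using K \<epsilon> by (simp add: l_def log_def ln_div diff_divide_distrib)
    also have "\<dots> \<le> \<bar>log 2 K\<bar> + l / ln 2" by simp
    finally have "log 2 (K / \<epsilon>) \<le> \<bar>log 2 K\<bar> + l / ln 2" .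
    moreover have "0 \<le> \<bar>log 2 K\<bar> + l / ln 2" using l by simp
    ultimately have "real d \<le> \<bar>log 2 K\<bar> + l / ln 2 + 1"
      unfolding d_def by linarith
    also have "\<dots> \<le> \<bar>log 2 K\<bar> * l + l / ln 2 + l"
      using l mult_left_mono[OF l, of "\<bar>log 2 K\<bar>"] by simp
    also have "\<dots> = C * l"
      by (simp add: C_def algebra_simps)
    finally show ?thesis .
  qed
  ultimately show "\<exists>d. K / 2 ^ d \<le> \<epsilon> \<and> real d \<le> C * ln (1 / \<epsilon>)"
    unfolding l_def by blast
qed

theorem theorem3p1:
  fixes \<Phi> :: "real ^ 2 \<Rightarrow> real ^ 2 \<Rightarrow> real" and Q R :: real
  assumes "smooth_phase \<Phi>"
    and "homogeneous_phase \<Phi>"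
    and "Q > 0" and "R > 0"
    and "analytic_bound Q R (Psi \<Phi>)"
  shows "\<exists>\<epsilon>\<^sub>0 (N\<^sub>0::nat) C. 0 < \<epsilon>\<^sub>0 \<and> \<epsilon>\<^sub>0 < 1 \<and> 0 < C \<and>
    (\<forall>N \<epsilon> A B.
       N \<ge> N\<^sub>0 \<and> (\<exists>L. N = 2 ^ L) \<and> 0 < \<epsilon> \<and> \<epsilon> \<le> \<epsilon>\<^sub>0 \<and>
       A \<in> quadtree N \<and> B \<in> quadtree N \<and> width A * width B = 1 / real N \<longrightarrow>
       (\<exists>r::nat. real r \<le> C * ln (1 / \<epsilon>) ^ 4 \<and>
          (\<exists>\<alpha> \<beta>. separated_approx (Psi \<Phi>) N \<epsilon> A B r \<alpha> \<beta>) \<and>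
          (width B \<le> 1 / sqrt (real N) \<longrightarrow>
             (\<exists>\<alpha> \<beta>. separated_approx (Psi \<Phi>) N \<epsilon> A B r \<alpha> \<beta> \<and>
                    centered_monomials B r (C * ln (1 / \<epsilon>) ^ 2) \<beta>)) \<and>
          (width A \<le> 1 / sqrt (real N) \<longrightarrow>
             (\<exists>\<alpha> \<beta>. separated_approx (Psi \<Phi>) N \<epsilon> A B r \<alpha> \<beta> \<and>
                    centered_monomials A r (C * ln (1 / \<epsilon>) ^ 2) \<alpha>))))"
proof -
  note Q = assms(3) and R = assms(4)
  define f where "f = Psi \<Phi>"
  have f: "smooth_kernel f"
    unfolding f_def by (rule smooth_kernel_Psi[OF assms(1)])
  have f_swap: "smooth_kernel (\<lambda>p x. f x p)"
    by (rule smooth_kernel_swap[OF f])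
  have bound: "\<bar>partial_x m ((partial_p 1 ^^ a) ((partial_p 2 ^^ b) f)) x p\<bar>
      \<le> Q / R * fact a * fact b / R ^ (a + b)"
    if "x \<in> unit_square" "p \<in> unit_square" for a b m x p
    using analytic_bound_x[OF assms(5)[folded f_def] that] .
  have bound_swap: "\<bar>partial_x m ((partial_p 1 ^^ a) ((partial_p 2 ^^ b) (\<lambda>p x. f x p))) p x\<bar>
      \<le> Q / R * fact a * fact b / R ^ (a + b)"
    if "p \<in> unit_square" "x \<in> unit_square" for a b m p x
    using analytic_bound_p[OF assms(5)[folded f_def] f that(2,1)]
    by (simp add: iterated_partial_p_swap partial_p_swap)
  define K where "K = 3 * pi * Q / R\<^sup>2"
  define K' where "K' = K + 2 * K * exp (4 * K)"
  have "0 < K" using Q R by (simp add: K_def)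
  then have "0 < K'" by (simp add: K'_def add_pos_pos)
  then obtain C where C: "0 < C"
    "\<And>\<epsilon>. 0 < \<epsilon> \<Longrightarrow> \<epsilon> \<le> exp (- 1) \<Longrightarrow> \<exists>d. K' / 2 ^ d \<le> \<epsilon> \<and> real d \<le> C * ln (1 / \<epsilon>)"
    using truncation_order by blast
  \<comment> \<open>This makes 1/sqrt N at most R/2, the size at which the Taylor expansion is
    allowed.\<close>
  obtain N\<^sub>0 :: nat where N\<^sub>0: "(2 / R)\<^sup>2 \<le> real N\<^sub>0"
    using real_arch_simple by blast
  \<comment> \<open>The square bounds the number of terms (d^2 + 1)^2; being at least 2 C^2, it also
    bounds the total degree 2 d^2.\<close>
  define C' where "C' = (C\<^sup>2 + 1)\<^sup>2"
  have claim: "\<exists>r::nat. real r \<le> C' * ln (1 / \<epsilon>) ^ 4 \<and>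
          (\<exists>\<alpha> \<beta>. separated_approx f N \<epsilon> A B r \<alpha> \<beta>) \<and>
          (width B \<le> 1 / sqrt (real N) \<longrightarrow>
             (\<exists>\<alpha> \<beta>. separated_approx f N \<epsilon> A B r \<alpha> \<beta> \<and>
                    centered_monomials B r (C' * ln (1 / \<epsilon>) ^ 2) \<beta>)) \<and>
          (width A \<le> 1 / sqrt (real N) \<longrightarrow>
             (\<exists>\<alpha> \<beta>. separated_approx f N \<epsilon> A B r \<alpha> \<beta> \<and>
                    centered_monomials A r (C' * ln (1 / \<epsilon>) ^ 2) \<alpha>))"
    if N: "N\<^sub>0 \<le> N" "N = 2 ^ L" and \<epsilon>: "0 < \<epsilon>" "\<epsilon> \<le> exp (- 1)"
      and AB: "A \<in> quadtree N" "B \<in> quadtree N" and w: "width A * width B = 1 / real N"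
    for N L \<epsilon> A B
  proof -
    obtain d where d: "K' / 2 ^ d \<le> \<epsilon>" "real d \<le> C * ln (1 / \<epsilon>)"
      using C(2)[OF \<epsilon>] by blast
    define l where "l = ln (1 / \<epsilon>)"
    \<comment> \<open>The same \<open>r\<close> serves both expansions, as the single rank in the
      conclusion requires.\<close>
    define r where "r = (d * d + 1)\<^sup>2"
    have N_pos: "0 < real N" using N(2) by simp
    have A: "points A \<subseteq> unit_square" and B: "points B \<subseteq> unit_square"
      using AB by (auto simp: quadtree_def)
    have wN: "real N * width A * width B = 1" "real N * width B * width A = 1"
      using w N_pos by (simp_all add: field_simps)
    have "2 / R \<le> sqrt (real N)"
      using N\<^sub>0 N(1) R by (intro real_le_rsqrt) simp
    then have small: "1 / sqrt (real N) \<le> R / 2"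
      using R N_pos by (simp add: field_simps)
    have "ln \<epsilon> \<le> ln (exp (- 1))"
      using \<epsilon> by (subst ln_le_cancel_iff) auto
    then have l: "1 \<le> l"
      using \<epsilon> by (simp add: l_def ln_div)
    have dd: "real (d * d) \<le> C\<^sup>2 * l\<^sup>2"
      using power_mono[OF d(2), of 2] by (simp add: l_def power2_eq_square mult_ac)
    have "1 \<le> l\<^sup>2" using l by simp
    then have "real (d * d + 1) \<le> (C\<^sup>2 + 1) * l\<^sup>2"
      using dd by (simp add: distrib_right)
    then have "(real (d * d + 1))\<^sup>2 \<le> ((C\<^sup>2 + 1) * l\<^sup>2)\<^sup>2"
      by (rule power_mono) simp
    then have r: "real r \<le> C' * l ^ 4"
      by (simp add: r_def C'_def power_mult_distrib flip: power_mult)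
    have "2 * C\<^sup>2 \<le> C'"
      using zero_le_power2[of "C\<^sup>2"] by (simp add: C'_def power2_sum)
    then have "2 * C\<^sup>2 * l\<^sup>2 \<le> C' * l\<^sup>2"
      by (rule mult_right_mono) simp
    then have degree: "real (2 * (d * d)) \<le> C' * l\<^sup>2"
      using dd by simp
    have caseB: "\<exists>\<alpha> \<beta>. separated_approx f N \<epsilon> A B r \<alpha> \<beta> \<and> centered_monomials B r (C' * l\<^sup>2) \<beta>"
      if "width B \<le> 1 / sqrt (real N)"
    proof -
      have wB: "width B \<le> R / 2" using that small by simp
      obtain c where "separated_approx f N (K' / 2 ^ d) A B r c
          (\<lambda>t p. of_real (mi_power (p - center B) (mono_index (d * d) t)))"
        using separated_approximation[OF f Q R bound A B wN(1) wB K_def, of d]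
        unfolding r_def K'_def by blast
      then show ?thesis
        using separated_approx_mono[OF _ d(1)] centered_monomials_mono_index[OF degree, of B]
        unfolding r_def by blast
    qed
    have caseA: "\<exists>\<alpha> \<beta>. separated_approx f N \<epsilon> A B r \<alpha> \<beta> \<and> centered_monomials A r (C' * l\<^sup>2) \<alpha>"
      if "width A \<le> 1 / sqrt (real N)"
    proof -
      have wA: "width A \<le> R / 2" using that small by simp
      obtain c where "separated_approx (\<lambda>p x. f x p) N (K' / 2 ^ d) B A r c
          (\<lambda>t x. of_real (mi_power (x - center A) (mono_index (d * d) t)))"
        using separated_approximation[OF f_swap Q R bound_swap B A wN(2) wA K_def, of d]
        unfolding r_def K'_def by blast
      then have "separated_approx f N (K' / 2 ^ d) A B r
          (\<lambda>t x. of_real (mi_power (x - center A) (mono_index (d * d) t))) c"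
        by (rule separated_approx_swap)
      then show ?thesis
        using separated_approx_mono[OF _ d(1)] centered_monomials_mono_index[OF degree, of A]
        unfolding r_def by blast
    qed
    \<comment> \<open>If both sides exceeded 1/sqrt N, their product would exceed 1/N. So one
      expansion always applies and provides the unconditional approximation.\<close>
    have "width A \<le> 1 / sqrt (real N) \<or> width B \<le> 1 / sqrt (real N)"
    proof (rule ccontr)
      assume "\<not> ?thesis"
      then have "1 / sqrt (real N) * (1 / sqrt (real N)) < width A * width B"
        using N_pos width_pos by (intro mult_strict_mono) auto
      then show False using w by simp
    qed
    with caseA caseB r show ?thesis
      unfolding l_def by blast
  qed
  show ?thesis
    unfolding f_def[symmetric]
  proof (rule exI[of _ "exp (- 1)"], rule exI[of _ N\<^sub>0], rule exI[of _ C'], safe)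
    show "0 < C'"
      unfolding C'_def by (intro zero_less_power add_nonneg_pos) auto
  qed (use claim in auto)
qed

end
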